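(* In the group \(\mathcal{G}\) described below, the subgroup \(\mathcal{M}=\langle x,y,s_1\rangle\) is isomorphic to \(2^3:L_3(2)\).
   Context: Let \(\mathcal{G}=\langle x,y,t \mid x^7, y^2, (xy)^3, [x,y]^4, t^2, [t^{x^2},yx^{-1}], [t,y], (yt^{x^2})^5, (xyx^2t^x)^5, (xt)^8\rangle\), with \(a^g=g^{-1}ag\), \([a,b]=a^{-1}b^{-1}ab\). Let \(\mathcal{N}=\langle x,y\rangle\le\mathcal{G}\); it acts on \(\{1,\dots,14\}\) on the right via \(x\mapsto(1,2,3,4,5,6,7)(8,9,10,11,12,13,14)\), \(y\mapsto(1,12)(2,3)(4,11)(5,8)(6,13)(9,10)\). Put \(t_7=t\) and \(t_i=t^g\) for any \(g\in\mathcal{N}\) mapping \(7\) to \(i\); indices are taken modulo 14, and \(s_1=t_1t_8\). Here \(2^3:L_3(2)\) denotes the semidirect product of the elementary abelian group of order 8 by \(L_3(2)=GL_3(\mathbb{F}_2)\) acting naturally. *)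

theory Defs
  imports "HOL-Analysis.Finite_Cartesian_Product" "HOL-Library.Z2"
          "HOL-Algebra.Group" "HOL-Algebra.Generated_Groups"
begin

datatype gen = GX | GY | GT

text \<open>A word is a list of letters; (False, g) is the generator g, (True, g) its inverse.\<close>
type_synonym word = "(bool \<times> gen) list"

definition winv :: "word \<Rightarrow> word" where
  "winv w = rev (map (\<lambda>(b, g). (\<not> b, g)) w)"

definition wpow :: "word \<Rightarrow> nat \<Rightarrow> word" where
  "wpow w n = concat (replicate n w)"

definition wcomm :: "word \<Rightarrow> word \<Rightarrow> word" where
  "wcomm a b = winv a @ winv b @ a @ b"

definition wconj :: "word \<Rightarrow> word \<Rightarrow> word" where
  "wconj a g = winv g @ a @ g"

inductive pres_eq :: "word set \<Rightarrow> word \<Rightarrow> word \<Rightarrow> bool" for R where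
  pe_refl: "pres_eq R w w"
| pe_sym: "pres_eq R u v \<Longrightarrow> pres_eq R v u"
| pe_trans: "pres_eq R u v \<Longrightarrow> pres_eq R v w \<Longrightarrow> pres_eq R u w"
| pe_cancel: "pres_eq R (u @ [(b, g), (\<not> b, g)] @ v) (u @ v)"
| pe_rel: "r \<in> R \<Longrightarrow> pres_eq R (u @ r @ v) (u @ v)"

definition pcls :: "word set \<Rightarrow> word \<Rightarrow> word set" where
  "pcls R w = {v. pres_eq R w v}"

definition pres_group :: "word set \<Rightarrow> word set monoid" where
  "pres_group R = \<lparr> carrier = {pcls R w | w. True},
                    mult = (\<lambda>A B. {v. \<exists>a\<in>A. \<exists>b\<in>B. pres_eq R (a @ b) v}),
                    one = pcls R [] \<rparr>"

abbreviation "wx \<equiv> [(False, GX)]"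
abbreviation "wy \<equiv> [(False, GY)]"
abbreviation "wt \<equiv> [(False, GT)]"

definition G_relators :: "word set" where
  "G_relators =
    { wpow wx 7,
      wpow wy 2,
      wpow (wx @ wy) 3,
      wpow (wcomm wx wy) 4,
      wpow wt 2,
      wcomm (wconj wt (wpow wx 2)) (wy @ winv wx),
      wcomm wt wy,
      wpow (wy @ wconj wt (wpow wx 2)) 5,
      wpow (wx @ wy @ wpow wx 2 @ wconj wt wx) 5,
      wpow (wx @ wt) 8 }"

definition GG :: "word set monoid" where
  "GG = pres_group G_relators"

definition gx :: "word set" where "gx = pcls G_relators wx"
definition gy :: "word set" where "gy = pcls G_relators wy"

text \<open>t_1 = t^x (x maps 7 to 1); t_8 = t^(x^5 y) (x^5 y maps 7 to 5 to 8).\<close>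
definition t1_word :: word where "t1_word = wconj wt wx"
definition t8_word :: word where "t8_word = wconj wt (wpow wx 5 @ wy)"

definition gs1 :: "word set" where "gs1 = pcls G_relators (t1_word @ t8_word)"

text \<open>Semidirect product F_2^3 : GL_3(F_2) with the natural action:
  (v,A)(w,B) = (v + A w, A B), i.e. the affine group of F_2^3.\<close>
definition AGL32 :: "((bit^3) \<times> (bit^3^3)) monoid" where
  "AGL32 = \<lparr> carrier = {(v, A). invertible A},
             mult = (\<lambda>(v, A) (w, B). (v + A *v w, A ** B)),
             one = (0, mat 1) \<rparr>"

end

theory Submission
  imports Defs "HOL-Analysis.Cartesian_Space"
begin

text \<open>
  Write \<open>N\<close> for the subgroup generated by \<open>x\<close> and \<open>y\<close>. Its four relators present a group of order
  168 (normal forms come from the double cosets of \<open>\<langle>x\<rangle>\<close>), so an equation in \<open>N\<close> can be decided by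
  the action of \<open>N\<close> on the 14 conjugates \<open>t\<^sub>i\<close> of \<open>t\<close>. Every element of the group is
  a product of \<open>t\<^sub>i\<close>'s times an element of \<open>N\<close>, and relations between such products may be conjugated
  freely by \<open>N\<close>. The two relators of exponent 5 then yield \<open>t\<^sub>1 t\<^sub>8 = t\<^sub>8 t\<^sub>1\<close> and
  \<open>s\<^sub>1 s\<^sub>2 = s\<^sub>6\<close>. Since \<open>N\<close> is 2-transitive on the seven \<open>s\<^sub>i\<close>, these and 1 form an elementary
  abelian group of order 8 normalised by \<open>N\<close>, and every element of \<open>M\<close> is one of them times an element of \<open>N\<close>.

  Conversely, the group acts on 22 points (as the Mathieu group \<open>M\<^sub>2\<^sub>2\<close>) and \<open>M\<close> preserves a set
  of eight of them, on which the \<open>s\<^sub>i\<close> act as the nonzero translations of \<open>F\<^sub>2\<^sup>3\<close> and \<open>N\<close> by affine maps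
  whose linear parts make up \<open>GL\<^sub>3(2)\<close>. Sending an element of \<open>M\<close> to its affine map is the required
  isomorphism. Here \<open>N\<close> does not fix any of the eight points: it corresponds to a complement of the
  translations other than \<open>GL\<^sub>3(2)\<close> itself.
\<close>

section \<open>Words modulo relators\<close>

lemma pres_eq_append_left: "pres_eq R u v \<Longrightarrow> pres_eq R (w @ u) (w @ v)"
proof (induction rule: pres_eq.induct)
  case (pe_cancel u b g v)
  then show ?case using pres_eq.pe_cancel[of R "w @ u" b g v] by simp
next
  case (pe_rel r u v)
  then show ?case using pres_eq.pe_rel[of r R "w @ u" v] by simp
qed (auto intro: pres_eq.intros)

lemma pres_eq_append_right: "pres_eq R u v \<Longrightarrow> pres_eq R (u @ w) (v @ w)"
proof (induction rule: pres_eq.induct)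
  case (pe_cancel u b g v)
  then show ?case using pres_eq.pe_cancel[of R u b g "v @ w"] by simp
next
  case (pe_rel r u v)
  then show ?case using pres_eq.pe_rel[of r R u "v @ w"] by simp
qed (auto intro: pres_eq.intros)

lemma pres_eq_append:
  "pres_eq R u u' \<Longrightarrow> pres_eq R v v' \<Longrightarrow> pres_eq R (u @ v) (u' @ v')"
  by (meson pe_trans pres_eq_append_left pres_eq_append_right)

lemma winv_simps [simp]:
  "winv [] = []" "winv ((b, g) # w) = winv w @ [(\<not> b, g)]" "winv (u @ v) = winv v @ winv u"
  "winv (winv w) = w"
  by (simp_all add: winv_def rev_map comp_def case_prod_beta)

lemma pres_eq_winv_right: "pres_eq R (w @ winv w) []"
proof (induction w)
  case (Cons c w)
  obtain b g where c: "c = (b, g)" by (cases c)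
  have "pres_eq R ([c] @ (w @ winv w) @ [(\<not> b, g)]) ([c] @ [] @ [(\<not> b, g)])"
    by (intro pres_eq_append Cons.IH pe_refl)
  then show ?case
    using pres_eq.pe_cancel[of R "[]" b g "[]"] by (auto simp: c intro: pe_trans)
qed (simp add: pe_refl)

lemma pres_eq_winv_left: "pres_eq R (winv w @ w) []"
  using pres_eq_winv_right[of R "winv w"] by simp

lemma equivp_pres_eq: "equivp (pres_eq R)"
  by (intro equivpI reflpI sympI transpI) (auto intro: pres_eq.intros)

lemma pres_eq_rel: "r \<in> R \<Longrightarrow> pres_eq R r []"
  using pe_rel[of r R "[]" "[]"] by simp

lemma pres_eq_mono:
  assumes "R \<subseteq> S" shows "pres_eq R u v \<Longrightarrow> pres_eq S u v"
  by (induction rule: pres_eq.induct) (use assms in \<open>auto intro: pres_eq.intros simp del: append_Cons append.simps\<close>)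

section \<open>Words acting on a set\<close>

definition act :: "(bool \<times> gen \<Rightarrow> 'a \<Rightarrow> 'a) \<Rightarrow> word \<Rightarrow> 'a \<Rightarrow> 'a" where
  "act f w = foldr f w"

lemma act_simps [simp]:
  "act f [] i = i" "act f (c # w) i = f c (act f w i)" "act f (u @ v) i = act f u (act f v i)"
  by (simp_all add: act_def)

lemma act_closed:
  "(\<And>c i. i \<in> A \<Longrightarrow> f c i \<in> A) \<Longrightarrow> i \<in> A \<Longrightarrow> act f w i \<in> A"
  by (induction w) auto

text \<open>Soundness: tables for the letters that respect inverses and relators define an action of
  the presented group. The point stays arbitrary in the induction because a common suffix moves it
  first, and closure of \<open>A\<close> keeps it where the tables are meaningful.\<close>

lemma pres_eq_act:
  assumes closed: "\<And>c i. i \<in> A \<Longrightarrow> f c i \<in> A"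
    and inv: "\<And>b g i. i \<in> A \<Longrightarrow> f (b, g) (f (\<not> b, g) i) = i"
    and l32_relations: "\<And>r i. r \<in> R \<Longrightarrow> i \<in> A \<Longrightarrow> act f r i = i"
  shows "pres_eq R u v \<Longrightarrow> i \<in> A \<Longrightarrow> act f u i = act f v i"
  by (induction arbitrary: i rule: pres_eq.induct) (simp_all add: inv l32_relations act_closed closed)

section \<open>The subgroup generated by x and y\<close>

definition L32_relators :: "word set" where
  "L32_relators = {wpow wx 7, wpow wy 2, wpow (wx @ wy) 3, wpow (wcomm wx wy) 4}"

\<comment> \<open>A type, so that the simplifier can rewrite equations between words. It is the
  group presented by the four relators alone; \<open>l32_eq_G_eq\<close> carries its equations over
  to the whole group. Only the monoid structure is declared, and inverses enter as classes of the
  inverse letters.\<close>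
quotient_type l32 = word / "pres_eq L32_relators"
  by (rule equivp_pres_eq)

instantiation l32 :: monoid_mult
begin

lift_definition one_l32 :: l32 is "[]" .
lift_definition times_l32 :: "l32 \<Rightarrow> l32 \<Rightarrow> l32" is append by (rule pres_eq_append)

instance
  by standard (transfer, simp add: pe_refl)+

end

lemma abs_l32_append: "abs_l32 (u @ v) = abs_l32 u * abs_l32 v"
  by (simp add: times_l32.abs_eq)

lemma abs_l32_Nil: "abs_l32 [] = 1"
  by (simp add: one_l32_def)

lemma abs_l32_wpow: "abs_l32 (wpow w n) = abs_l32 w ^ n"
  by (induction n) (simp_all add: wpow_def abs_l32_append abs_l32_Nil)

abbreviation "X \<equiv> abs_l32 [(False, GX)]"
abbreviation "X' \<equiv> abs_l32 [(True, GX)]"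
abbreviation "Y \<equiv> abs_l32 [(False, GY)]"

lemma abs_l32_eq_iff: "abs_l32 u = abs_l32 v \<longleftrightarrow> pres_eq L32_relators u v"
  by (rule l32.abs_eq_iff)

lemma abs_l32_cancel: "abs_l32 [(b, g)] * abs_l32 [(\<not> b, g)] = 1"
  unfolding abs_l32_append[symmetric] abs_l32_Nil[symmetric] abs_l32_eq_iff
  using pe_cancel[of L32_relators "[]" b g "[]"] by simp

lemma X_X': "X * X' = 1" and X'_X: "X' * X = 1" and Y_Y_inv: "Y * abs_l32 [(True, GY)] = 1"
  using abs_l32_cancel[of False] abs_l32_cancel[of True] by simp_all

lemma l32_relations: "X ^ 7 = 1" "Y ^ 2 = 1" "(X * Y) ^ 3 = 1" "(X' * abs_l32 [(True, GY)] * (X * Y)) ^ 4 = 1"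
proof -
  have "pres_eq L32_relators r []" if "r \<in> L32_relators" for r
    by (rule pres_eq_rel[OF that])
  note * = this[folded abs_l32_eq_iff, unfolded abs_l32_Nil L32_relators_def]
  show "X ^ 7 = 1" "Y ^ 2 = 1" "(X * Y) ^ 3 = 1" "(X' * abs_l32 [(True, GY)] * (X * Y)) ^ 4 = 1"
    using *[of "wpow wx 7"] *[of "wpow wy 2"] *[of "wpow (wx @ wy) 3"] *[of "wpow (wcomm wx wy) 4"]
    by (simp_all only: insert_iff simp_thms abs_l32_wpow abs_l32_append wcomm_def winv_simps append_Nil
        not_False_eq_True mult.assoc)
qed

lemma Y_Y: "Y * Y = 1" using l32_relations(2) by (simp add: power2_eq_square)
lemma Y_inv: "abs_l32 [(True, GY)] = Y"
  by (metis Y_Y_inv Y_Y mult.assoc mult_1_left mult_1_right)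

text \<open>
  A primed equation is the unprimed one followed by an arbitrary right factor, so that it also rewrites
  inside a right-associated product. In the names below, capitals stand for inverses
  and \<open>p = yxxy\<close>, \<open>q = yxxxy\<close>, \<open>z = yxxxyXXy\<close>, \<open>Z = z\<^sup>-\<^sup>1\<close>.
\<close>

lemma mult_ctx: "a = b \<Longrightarrow> a * z = b * (z::l32)" by simp

lemmas X_X'' = X_X'[THEN mult_ctx, unfolded mult.assoc mult_1_left]
lemmas X'_X' = X'_X[THEN mult_ctx, unfolded mult.assoc mult_1_left]
lemmas Y_Y' = Y_Y[THEN mult_ctx, unfolded mult.assoc mult_1_left]
lemmas l32_simps = X_X' X'_X Y_Y X_X'' X'_X' Y_Y' mult.assoc

section \<open>Rewriting rules for products of \<open>X\<close> and \<open>Y\<close>\<close>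

lemma yxy: "Y * (X * Y) = X' * (Y * X')"
proof -
  have "Y * (X * Y) = X' * (X * Y) ^ 3 * (Y * X')" by (simp add: l32_simps numeral_eq_Suc)
  then show ?thesis by (simp only: l32_relations mult_1_right)
qed
lemmas yxy' = yxy[THEN mult_ctx, unfolded mult.assoc]

text \<open>The inverse of \<open>yxy\<close>. The factor inserted in the first step is 1, written
  so that \<open>yxy\<close> applies to it backwards.\<close>

lemma yXy: "Y * (X' * Y) = X * (Y * X)"
proof -
  have "Y * (X' * Y) = Y * (X' * (Y * ((X' * (Y * X')) * (X * (Y * X)))))" by (simp add: l32_simps)
  also have "\<dots> = X * (Y * X)" by (simp add: yxy[symmetric] l32_simps)
  finally show ?thesis .
qed
lemmas yXy' = yXy[THEN mult_ctx, unfolded mult.assoc]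

lemma x4: "X * (X * (X * X)) = X' * (X' * X')"
proof -
  have "X * (X * (X * X)) = X ^ 7 * (X' * (X' * X'))" by (simp add: l32_simps numeral_eq_Suc)
  then show ?thesis by (simp only: l32_relations mult_1_left)
qed
lemmas x4' = x4[THEN mult_ctx, unfolded mult.assoc]

lemma XXXX: "X' * (X' * (X' * X')) = X * (X * X)"
proof -
  have "X' * (X' * (X' * X')) = X ^ 7 * (X' * (X' * (X' * X')))" by (simp only: l32_relations mult_1_left)
  then show ?thesis by (simp add: l32_simps numeral_eq_Suc)
qed
lemma yXXy: "Y * (X' * (X' * Y)) = X * (Y * (X * (X * (Y * X))))"
proof -
  have "Y * (X' * (X' * Y)) = Y * (X' * Y) * (Y * (X' * Y))" by (simp add: l32_simps)
  then show ?thesis by (simp only: yXy) (simp add: l32_simps)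
qed
lemmas yXXy' = yXXy[THEN mult_ctx, unfolded mult.assoc]

text \<open>By \<open>yxy\<close> the commutator of \<open>x\<close> and \<open>y\<close> equals
  \<open>x^-2 y x^-1\<close>, a conjugate of \<open>x^-3 y\<close>, so the fourth relator becomes a
  statement about \<open>x^-3 y\<close>.\<close>

lemma XXXy4: "(X' * (X' * (X' * Y))) ^ 4 = 1"
proof -
  let ?c = "X' * Y * (X * Y)"
  have c: "?c = X' * (X' * (Y * X'))" by (simp add: l32_simps yxy)
  have "(X' * (X' * (X' * Y))) ^ 4 = X' * ?c ^ 4 * X"
    unfolding c by (simp add: numeral_eq_Suc l32_simps)
  then show ?thesis using l32_relations(4) by (simp only: Y_inv mult_1_right X'_X)
qed

lemma yXXXy: "Y * (X' * (X' * (X' * Y))) = X * (X * (X * (Y * (X * (X * (X * (Y * (X * (X * X)))))))))"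
proof -
  have "Y * (X' * (X' * (X' * Y))) = X * (X * (X * ((X' * (X' * (X' * Y))) ^ 4
      * (Y * (X * (X * (X * (Y * (X * (X * X))))))))))"
    by (simp add: l32_simps numeral_eq_Suc)
  then show ?thesis by (simp only: XXXy4 mult_1_left)
qed
lemma qxxxy: "Y * (X * (X * (X * (Y * (X * (X * (X * Y))))))) = X' * (X' * (X' * (Y * (X' * (X' * X')))))"
proof -
  have "Y * (X * (X * (X * (Y * (X * (X * (X * Y))))))) = X' * (X' * (X' * (Y * (X' * (X' * (X' * Y))) * Y)))"
    unfolding yXXXy by (simp add: l32_simps)
  then show ?thesis by (simp add: l32_simps)
qed

lemma yXXyXXy: "Y * (X' * (X' * (Y * (X' * (X' * Y))))) = X * (Y * (X * (X * (X * (Y * X)))))"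
proof -
  \<comment> \<open>\<open>yXXXy\<close> and repeated use of \<open>yxy\<close> collapse the right
    side. Its last factor \<open>x^-2 y x^2 y\<close> is there to cancel against the
    \<open>y x^-2 y\<close> that follows it below.\<close>
  have key: "X * (X * (Y * (X' * X'))) = Y * (X' * (X' * (X' * Y))) * (X' * (X' * (Y * (X * (X * Y)))))"
    unfolding yXXXy by (simp add: l32_simps yxy yxy')
  have "Y * (X' * (X' * (Y * (X' * (X' * Y))))) = X' * (X' * (X * (X * (Y * (X' * X'))) * (Y * (X' * (X' * Y)))))"
    by (simp add: l32_simps)
  also have "\<dots> = X' * (X' * (Y * (X' * (X' * (X' * Y))) * (X' * X')))"
    unfolding key by (simp add: l32_simps)
  also have "\<dots> = X * (Y * (X * (X * (X * (Y * X)))))"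
    unfolding yXXXy by (simp add: l32_simps)
  finally show ?thesis .
qed

text \<open>The left side is the inverse of that of \<open>yXXyXXy\<close>. The inserted factor is
  that lemma's right side times its inverse; once the former is replaced, it cancels against the
  left side, and \<open>yXXXy\<close> makes the remaining exponents positive.\<close>

lemma yxxyxxy: "Y * (X * (X * (Y * (X * (X * Y))))) = X * (X * (Y * (X * (X * (X * (Y * (X * X)))))))"
proof -
  have "Y * (X * (X * (Y * (X * (X * Y))))) = Y * (X * (X * (Y * (X * (X * Y))))) *
      ((X * (Y * (X * (X * (X * (Y * X)))))) * (X' * (Y * (X' * (X' * (X' * Y)))) * X'))"
    by (simp add: l32_simps)
  also have "\<dots> = X' * (Y * (X' * (X' * (X' * Y)))) * X'"
    unfolding yXXyXXy[symmetric] by (simp add: l32_simps)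
  finally show ?thesis unfolding yXXXy by (simp add: l32_simps)
qed
lemma yxxyxxxy: "Y * (X * (X * (Y * (X * (X * (X * Y)))))) = X * (X * (Y * (X * (X * (Y * (X' * X'))))))"
proof -
  have "Y * (X * (X * (Y * (X * (X * (X * Y)))))) = Y * (X * (X * (Y * (X * (X * Y))))) * (Y * (X * Y))"
    by (simp add: l32_simps)
  also have "\<dots> = X * (X * (Y * (X * (X * (Y * (X' * X'))))))"
    unfolding yxxyxxy by (simp add: l32_simps yxy yxy')
  finally show ?thesis .
qed

abbreviation xl ("\<xi>") where "\<xi> \<equiv> (False, GX)"
abbreviation xl' ("\<xi>''") where "\<xi>' \<equiv> (True, GX)"
abbreviation yl ("\<eta>") where "\<eta> \<equiv> (False, GY)"

definition nword :: "word \<Rightarrow> bool" where "nword w \<longleftrightarrow> snd ` set w \<subseteq> {GX, GY}"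
definition xword :: "word \<Rightarrow> bool" where "xword w \<longleftrightarrow> snd ` set w \<subseteq> {GX}"

lemma nword_simps [simp]:
  "nword []" "nword ((b, g) # w) \<longleftrightarrow> g \<noteq> GT \<and> nword w" "nword (u @ v) \<longleftrightarrow> nword u \<and> nword v"
  "nword (winv w) \<longleftrightarrow> nword w"
  by (cases g; auto simp: nword_def winv_def image_image case_prod_beta)+

lemma xword_simps [simp]:
  "xword []" "xword ((b, g) # w) \<longleftrightarrow> g = GX \<and> xword w" "xword (u @ v) \<longleftrightarrow> xword u \<and> xword v"
  by (auto simp: xword_def)

abbreviation l32_eq (infix "\<sim>" 50) where "u \<sim> v \<equiv> pres_eq L32_relators u v"

text \<open>
  The double cosets of \<open>\<langle>x\<rangle>\<close> are three of size 49, represented by \<open>y\<close>, \<open>p\<close> and \<open>q\<close>, and the three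
  cosets \<open>\<langle>x\<rangle>\<close>, \<open>\<langle>x\<rangle>z\<close>, \<open>\<langle>x\<rangle>Z\<close>, which make up the normaliser of \<open>\<langle>x\<rangle>\<close>.
\<close>

definition long_mids :: "word list" where
  "long_mids = [[\<eta>], [\<eta>, \<xi>, \<xi>, \<eta>], [\<eta>, \<xi>, \<xi>, \<xi>, \<eta>]]"
definition short_mids :: "word list" where
  "short_mids = [[], [\<eta>, \<xi>, \<xi>, \<xi>, \<eta>, \<xi>', \<xi>', \<eta>], [\<eta>, \<xi>, \<xi>, \<eta>, \<xi>', \<xi>', \<xi>', \<eta>]]"

definition normal_form :: "word \<Rightarrow> bool" where
  "normal_form w \<longleftrightarrow> (\<exists>u r v. xword u \<and> xword v \<and> w \<sim> u @ r @ v \<and>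
     (r \<in> set long_mids \<or> r \<in> set short_mids \<and> v = []))"

lemma normal_formI:
  assumes "xword u" "xword v" "abs_l32 w = abs_l32 (u @ r @ v)"
    "r \<in> set long_mids \<or> r \<in> set short_mids \<and> v = []"
  shows "normal_form w"
  using assms unfolding normal_form_def abs_l32_eq_iff by blast

lemma abs_l32_Cons: "abs_l32 (c # d # w) = abs_l32 [c] * abs_l32 (d # w)"
  using abs_l32_append[of "[c]" "d # w"] by simp

section \<open>Multiplication of the double coset representatives\<close>

lemma qxxy: "Y * (X * (X * (X * (Y * (X * (X * Y)))))) = X' * (X' * (Y * (X * (X * (Y * (X * X))))))"
proof -
  have "Y * (X * (X * (X * (Y * (X * (X * Y)))))) = X' * (X' * (Y * (X * (X * (Y * (X * (X * Y))))) * Y))"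
    unfolding yxxyxxy by (simp add: l32_simps)
  then show ?thesis by (simp add: l32_simps)
qed

lemma pXXy: "Y * (X * (X * (Y * (X' * (X' * Y))))) = X' * (X' * (Y * (X * (X * (Y * (X * (X * X)))))))"
proof -
  have "Y * (X * (X * (Y * (X' * (X' * Y))))) = Y * (X * (X * (X * (Y * (X * (X * Y)))))) * X"
    unfolding yXXy by (simp add: l32_simps)
  then show ?thesis unfolding qxxy by (simp add: l32_simps)
qed

lemma qXy: "Y * (X * (X * (X * (Y * (X' * Y))))) = X * (X * (X * (Y * (X * (X * (X * (Y * (X' * (X' * X')))))))))"
proof -
  have "Y * (X * (X * (X * (Y * (X' * Y))))) = Y * (X' * (X' * (X' * Y))) * X"
    by (simp add: l32_simps yXy x4')
  then show ?thesis unfolding yXXXy by (simp add: l32_simps x4)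
qed

lemma qXXXy: "Y * (X * (X * (X * (Y * (X' * (X' * (X' * Y))))))) = X' * (X' * (X' * (Y * (X * (X * (X * (Y * X')))))))"
proof -
  have "Y * (X * (X * (X * (Y * (X' * (X' * (X' * Y))))))) = X' * (X' * (X' * (Y * (X * (X * (X * (Y * (X' * Y))))) * Y)))"
    unfolding qXy by (simp add: l32_simps)
  then show ?thesis by (simp add: l32_simps)
qed

lemmas normal_form_table_simps = long_mids_def short_mids_def abs_l32_Cons abs_l32_Nil l32_simps

text \<open>Needed for closing the normal forms under right multiplication by \<open>y\<close>: the
  words \<open>r x^k y\<close> for the three long middles \<open>r\<close> and \<open>k\<close> from
  -3 to 3, followed by \<open>z y\<close> and \<open>Z y\<close>.\<close>

lemma normal_form_table:
  "normal_form [\<eta>, \<eta>]"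
  "normal_form [\<eta>, \<xi>, \<eta>]"
  "normal_form [\<eta>, \<xi>, \<xi>, \<eta>]"
  "normal_form [\<eta>, \<xi>, \<xi>, \<xi>, \<eta>]"
  "normal_form [\<eta>, \<xi>', \<xi>', \<xi>', \<eta>]"
  "normal_form [\<eta>, \<xi>', \<xi>', \<eta>]"
  "normal_form [\<eta>, \<xi>', \<eta>]"
  "normal_form [\<eta>, \<xi>, \<xi>, \<eta>, \<eta>]"
  "normal_form [\<eta>, \<xi>, \<xi>, \<eta>, \<xi>, \<eta>]"
  "normal_form [\<eta>, \<xi>, \<xi>, \<eta>, \<xi>, \<xi>, \<eta>]"
  "normal_form [\<eta>, \<xi>, \<xi>, \<eta>, \<xi>, \<xi>, \<xi>, \<eta>]"
  "normal_form [\<eta>, \<xi>, \<xi>, \<eta>, \<xi>', \<xi>', \<xi>', \<eta>]"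
  "normal_form [\<eta>, \<xi>, \<xi>, \<eta>, \<xi>', \<xi>', \<eta>]"
  "normal_form [\<eta>, \<xi>, \<xi>, \<eta>, \<xi>', \<eta>]"
  "normal_form [\<eta>, \<xi>, \<xi>, \<xi>, \<eta>, \<eta>]"
  "normal_form [\<eta>, \<xi>, \<xi>, \<xi>, \<eta>, \<xi>, \<eta>]"
  "normal_form [\<eta>, \<xi>, \<xi>, \<xi>, \<eta>, \<xi>, \<xi>, \<eta>]"
  "normal_form [\<eta>, \<xi>, \<xi>, \<xi>, \<eta>, \<xi>, \<xi>, \<xi>, \<eta>]"
  "normal_form [\<eta>, \<xi>, \<xi>, \<xi>, \<eta>, \<xi>', \<xi>', \<xi>', \<eta>]"
  "normal_form [\<eta>, \<xi>, \<xi>, \<xi>, \<eta>, \<xi>', \<xi>', \<eta>]"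
  "normal_form [\<eta>, \<xi>, \<xi>, \<xi>, \<eta>, \<xi>', \<eta>]"
  "normal_form [\<eta>, \<xi>, \<xi>, \<xi>, \<eta>, \<xi>', \<xi>', \<eta>, \<eta>]"
  "normal_form [\<eta>, \<xi>, \<xi>, \<eta>, \<xi>', \<xi>', \<xi>', \<eta>, \<eta>]"
  subgoal by (rule normal_formI[where u = "[]" and r = "[]" and v = "[]"];
    simp add: normal_form_table_simps)
  subgoal by (rule normal_formI[where u = "[\<xi>']" and r = "[\<eta>]" and v = "[\<xi>']"];
    simp add: normal_form_table_simps yxy)
  subgoal by (rule normal_formI[where u = "[]" and r = "[\<eta>, \<xi>, \<xi>, \<eta>]" and v = "[]"];
    simp add: normal_form_table_simps)
  subgoal by (rule normal_formI[where u = "[]" and r = "[\<eta>, \<xi>, \<xi>, \<xi>, \<eta>]" and v = "[]"];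
    simp add: normal_form_table_simps)
  subgoal by (rule normal_formI[where u = "[\<xi>, \<xi>, \<xi>]" and r = "[\<eta>, \<xi>, \<xi>, \<xi>, \<eta>]" and v = "[\<xi>, \<xi>, \<xi>]"];
    simp add: normal_form_table_simps yXXXy)
  subgoal by (rule normal_formI[where u = "[\<xi>]" and r = "[\<eta>, \<xi>, \<xi>, \<eta>]" and v = "[\<xi>]"];
    simp add: normal_form_table_simps yXXy)
  subgoal by (rule normal_formI[where u = "[\<xi>]" and r = "[\<eta>]" and v = "[\<xi>]"];
    simp add: normal_form_table_simps yXy)
  subgoal by (rule normal_formI[where u = "[]" and r = "[\<eta>]" and v = "[\<xi>, \<xi>]"];
    simp add: normal_form_table_simps)
  subgoal by (rule normal_formI[where u = "[\<xi>']" and r = "[\<eta>]" and v = "[\<xi>', \<xi>']"];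
    simp add: normal_form_table_simps yxy yxy')
  subgoal by (rule normal_formI[where u = "[\<xi>, \<xi>]" and r = "[\<eta>, \<xi>, \<xi>, \<xi>, \<eta>]" and v = "[\<xi>, \<xi>]"];
    simp add: normal_form_table_simps yxxyxxy)
  subgoal by (rule normal_formI[where u = "[\<xi>, \<xi>]" and r = "[\<eta>, \<xi>, \<xi>, \<eta>]" and v = "[\<xi>', \<xi>']"];
    simp add: normal_form_table_simps yxxyxxxy)
  subgoal by (rule normal_formI[where u = "[]" and r = "[\<eta>, \<xi>, \<xi>, \<eta>, \<xi>', \<xi>', \<xi>', \<eta>]" and v = "[]"];
    simp add: normal_form_table_simps)
  subgoal by (rule normal_formI[where u = "[\<xi>', \<xi>']" and r = "[\<eta>, \<xi>, \<xi>, \<eta>]" and v = "[\<xi>, \<xi>, \<xi>]"];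
    simp add: normal_form_table_simps pXXy)
  subgoal by (rule normal_formI[where u = "[]" and r = "[\<eta>, \<xi>, \<xi>, \<xi>, \<eta>]" and v = "[\<xi>]"];
    simp add: normal_form_table_simps yXy)
  subgoal by (rule normal_formI[where u = "[]" and r = "[\<eta>]" and v = "[\<xi>, \<xi>, \<xi>]"];
    simp add: normal_form_table_simps)
  subgoal by (rule normal_formI[where u = "[]" and r = "[\<eta>, \<xi>, \<xi>, \<eta>]" and v = "[\<xi>']"];
    simp add: normal_form_table_simps yxy yxy')
  subgoal by (rule normal_formI[where u = "[\<xi>', \<xi>']" and r = "[\<eta>, \<xi>, \<xi>, \<eta>]" and v = "[\<xi>, \<xi>]"];
    simp add: normal_form_table_simps qxxy)
  subgoal by (rule normal_formI[where u = "[\<xi>', \<xi>', \<xi>']" and r = "[\<eta>]" and v = "[\<xi>', \<xi>', \<xi>']"];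
    simp add: normal_form_table_simps qxxxy)
  subgoal by (rule normal_formI[where u = "[\<xi>', \<xi>', \<xi>']" and r = "[\<eta>, \<xi>, \<xi>, \<xi>, \<eta>]" and v = "[\<xi>']"];
    simp add: normal_form_table_simps qXXXy)
  subgoal by (rule normal_formI[where u = "[]" and r = "[\<eta>, \<xi>, \<xi>, \<xi>, \<eta>, \<xi>', \<xi>', \<eta>]" and v = "[]"];
    simp add: normal_form_table_simps)
  subgoal by (rule normal_formI[where u = "[\<xi>, \<xi>, \<xi>]" and r = "[\<eta>, \<xi>, \<xi>, \<xi>, \<eta>]" and v = "[\<xi>', \<xi>', \<xi>']"];
    simp add: normal_form_table_simps qXy)
  subgoal by (rule normal_formI[where u = "[]" and r = "[\<eta>, \<xi>, \<xi>, \<xi>, \<eta>]" and v = "[\<xi>', \<xi>']"];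
    simp add: normal_form_table_simps)
  subgoal by (rule normal_formI[where u = "[]" and r = "[\<eta>, \<xi>, \<xi>, \<eta>]" and v = "[\<xi>', \<xi>', \<xi>']"];
    simp add: normal_form_table_simps)
  done

text \<open>\<open>z\<close> normalises \<open><x>\<close>, with \<open>z x z^-1 = x^-3\<close>;
  correspondingly \<open>Zx\<close> gives \<open>Z x Z^-1 = x^2\<close>, the exponents -3 and 2
  being inverse modulo 7. A power of \<open>x\<close> can thus be moved through a short middle to
  its left.\<close>

lemma zx:
  "abs_l32 [\<eta>, \<xi>, \<xi>, \<xi>, \<eta>, \<xi>', \<xi>', \<eta>, \<xi>] = abs_l32 [\<xi>', \<xi>', \<xi>', \<eta>, \<xi>, \<xi>, \<xi>, \<eta>, \<xi>', \<xi>', \<eta>]"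
proof -
  have "Y * (X * (X * (X * (Y * (X' * (X' * (Y * X))))))) = Y * (X' * (X' * (X' * (Y * (X * (X * (Y * (X * X))))))))"
    using yXXy' [of X] by (simp add: l32_simps x4')
  also have "\<dots> = Y * (X' * (Y * (X * (X * (X * (Y * (X * (X * Y))))))))"
    unfolding qxxy by (simp add: l32_simps)
  also have "\<dots> = X * (Y * (X' * (X' * (X' * Y))) * (X * (X * Y)))"
    by (simp add: l32_simps yXy' x4')
  also have "\<dots> = X' * (X' * (X' * (Y * (X * (X * (X * (Y * (X' * (X' * Y)))))))))"
    unfolding yXXXy by (simp add: l32_simps x4 x4')
  finally show ?thesis by (simp add: abs_l32_Cons l32_simps)
qed

lemma Zx:
  "abs_l32 [\<eta>, \<xi>, \<xi>, \<eta>, \<xi>', \<xi>', \<xi>', \<eta>, \<xi>] = abs_l32 [\<xi>, \<xi>, \<eta>, \<xi>, \<xi>, \<eta>, \<xi>', \<xi>', \<xi>', \<eta>]"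
proof -
  have "Y * (X * (X * (Y * (X' * (X' * (X' * (Y * X))))))) = Y * (X * (X * (Y * (X * (X * (X * (Y * (X' * Y))))))))"
    by (simp add: l32_simps yXy x4')
  also have "\<dots> = Y * (X * (X * (Y * (X * (X * (X * Y)))))) * (X' * Y)"
    by (simp add: l32_simps)
  also have "\<dots> = X * (X * (Y * (X * (X * (Y * (X' * (X' * (X' * Y))))))))"
    unfolding yxxyxxxy by (simp add: l32_simps)
  finally show ?thesis by (simp add: abs_l32_Cons l32_simps)
qed

lemma zX:
  "abs_l32 [\<eta>, \<xi>, \<xi>, \<xi>, \<eta>, \<xi>', \<xi>', \<eta>, \<xi>'] = abs_l32 [\<xi>, \<xi>, \<xi>, \<eta>, \<xi>, \<xi>, \<xi>, \<eta>, \<xi>', \<xi>', \<eta>]"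
proof -
  have "abs_l32 [\<xi>, \<xi>, \<xi>] * abs_l32 [\<eta>, \<xi>, \<xi>, \<xi>, \<eta>, \<xi>', \<xi>', \<eta>, \<xi>] * X' =
      abs_l32 [\<xi>, \<xi>, \<xi>] * abs_l32 [\<xi>', \<xi>', \<xi>', \<eta>, \<xi>, \<xi>, \<xi>, \<eta>, \<xi>', \<xi>', \<eta>] * X'"
    by (simp only: zx)
  then show ?thesis by (simp add: abs_l32_Cons l32_simps)
qed

lemma ZX:
  "abs_l32 [\<eta>, \<xi>, \<xi>, \<eta>, \<xi>', \<xi>', \<xi>', \<eta>, \<xi>'] = abs_l32 [\<xi>', \<xi>', \<eta>, \<xi>, \<xi>, \<eta>, \<xi>', \<xi>', \<xi>', \<eta>]"
proof -
  have "abs_l32 [\<xi>', \<xi>'] * abs_l32 [\<eta>, \<xi>, \<xi>, \<eta>, \<xi>', \<xi>', \<xi>', \<eta>, \<xi>] * X' =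
      abs_l32 [\<xi>', \<xi>'] * abs_l32 [\<xi>, \<xi>, \<eta>, \<xi>, \<xi>, \<eta>, \<xi>', \<xi>', \<xi>', \<eta>] * X'"
    by (simp only: Zx)
  then show ?thesis by (simp add: abs_l32_Cons l32_simps)
qed

lemma short_mids_shift:
  assumes "r \<in> set short_mids" "r \<noteq> []"
  shows "\<exists>u. xword u \<and> abs_l32 (r @ [\<xi>]) = abs_l32 (u @ r)"
    and "\<exists>u. xword u \<and> abs_l32 (r @ [\<xi>']) = abs_l32 (u @ r)"
proof -
  show "\<exists>u. xword u \<and> abs_l32 (r @ [\<xi>]) = abs_l32 (u @ r)"
    using assms zx exI[of "\<lambda>u. xword u \<and> abs_l32 (r @ [\<xi>]) = abs_l32 (u @ r)" "[\<xi>', \<xi>', \<xi>']"]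
      Zx exI[of "\<lambda>u. xword u \<and> abs_l32 (r @ [\<xi>]) = abs_l32 (u @ r)" "[\<xi>, \<xi>]"]
    by (auto simp: short_mids_def)
  show "\<exists>u. xword u \<and> abs_l32 (r @ [\<xi>']) = abs_l32 (u @ r)"
    using assms zX exI[of "\<lambda>u. xword u \<and> abs_l32 (r @ [\<xi>']) = abs_l32 (u @ r)" "[\<xi>, \<xi>, \<xi>]"]
      ZX exI[of "\<lambda>u. xword u \<and> abs_l32 (r @ [\<xi>']) = abs_l32 (u @ r)" "[\<xi>', \<xi>']"]
    by (auto simp: short_mids_def)
qed

definition xpows :: "word list" where
  "xpows = [[], [\<xi>], [\<xi>, \<xi>], [\<xi>, \<xi>, \<xi>], [\<xi>', \<xi>', \<xi>'], [\<xi>', \<xi>'], [\<xi>']]"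

lemma xword_xpows:
  "xword w \<Longrightarrow> \<exists>v\<in>set xpows. abs_l32 w = abs_l32 v"
proof (induction w)
  case (Cons c w)
  obtain b where c: "c = (b, GX)" using Cons.prems by (cases c) auto
  obtain v where v: "v \<in> set xpows" "abs_l32 w = abs_l32 v"
    using Cons c by auto
  have "abs_l32 (c # w) = abs_l32 (c # v)"
    using abs_l32_append[of "[c]" w] abs_l32_append[of "[c]" v] v(2) by simp
  moreover have "\<exists>v'\<in>set xpows. abs_l32 (c # v) = abs_l32 v'"
    using v(1) by (cases b) (auto simp: c xpows_def abs_l32_Cons abs_l32_Nil l32_simps x4 XXXX)
  ultimately show ?case by simp
qed (auto simp: xpows_def)

lemma normal_form_cong: "abs_l32 w = abs_l32 w' \<Longrightarrow> normal_form w \<longleftrightarrow> normal_form w'"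
  unfolding normal_form_def abs_l32_eq_iff[symmetric] by simp

lemma normal_form_prepend: "xword u \<Longrightarrow> normal_form w \<Longrightarrow> normal_form (u @ w)"
proof -
  assume u: "xword u" and "normal_form w"
  then obtain u' r v where *: "xword u'" "xword v" "abs_l32 w = abs_l32 (u' @ r @ v)"
      "r \<in> set long_mids \<or> r \<in> set short_mids \<and> v = []"
    unfolding normal_form_def abs_l32_eq_iff by blast
  then show ?thesis
    by (intro normal_formI[where u = "u @ u'" and r = r and v = v]) (simp_all add: u abs_l32_append mult.assoc)
qed

text \<open>An appended \<open>x\<close> joins the right power of a long middle or moves to the left
  through a short one. For an appended \<open>y\<close> the right power is first reduced to an
  exponent between -3 and 3, where \<open>normal_form_table\<close> applies.\<close>

lemma normal_form_snoc:
  assumes "normal_form w" "snd c \<noteq> GT"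
  shows "normal_form (w @ [c])"
proof -
  obtain u r v where *: "xword u" "xword v" "abs_l32 w = abs_l32 (u @ r @ v)"
      "r \<in> set long_mids \<or> r \<in> set short_mids \<and> v = []"
    using assms(1) unfolding normal_form_def abs_l32_eq_iff by blast
  have w: "abs_l32 (w @ [c]) = abs_l32 (u @ r @ v @ [c])"
    using *(3) by (simp add: abs_l32_append mult.assoc)
  have "normal_form (r @ v @ [c])"
  proof (cases "snd c")
    case GX
    show ?thesis
      using *(4)
    proof (elim disjE conjE)
      assume "r \<in> set long_mids"
      then show ?thesis using GX *(2)
        by (intro normal_formI[where u = "[]" and r = r and v = "v @ [c]"]; cases c) auto
    next
      assume v: "v = []" and r: "r \<in> set short_mids"
      have "\<exists>u. xword u \<and> abs_l32 (r @ [c]) = abs_l32 (u @ r)"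
      proof (cases "r = []")
        case True
        then show ?thesis using GX by (intro exI[of _ "[c]"]; cases c) auto
      next
        case False
        then show ?thesis using r GX short_mids_shift by (cases c; cases "fst c") auto
      qed
      then obtain u' where "xword u'" "abs_l32 (r @ [c]) = abs_l32 (u' @ r)" by blast
      then show ?thesis using r v by (intro normal_formI[where u = u' and r = r and v = "[]"]) simp_all
    qed
  next
    case GY
    obtain v' where v': "v' \<in> set xpows" "abs_l32 v = abs_l32 v'"
      using xword_xpows *(2) by blast
    have "abs_l32 (r @ v @ [c]) = abs_l32 (r @ v' @ [\<eta>])"
      using GY v'(2) by (cases c; cases "fst c") (auto simp: abs_l32_append Y_inv)
    moreover have "normal_form (r @ v' @ [\<eta>])"
    proof (cases "v = []")
      case True
      have "normal_form (r @ [\<eta>])" using *(4) True normal_form_table normal_formI[of "[]" "[]" "[\<eta>]" "[\<eta>]"]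
        by (auto simp: long_mids_def short_mids_def)
      \<comment> \<open>Only the class of \<open>v'\<close> is known to be trivial here, not
        \<open>v'\<close> itself.\<close>
      moreover have "abs_l32 (r @ v' @ [\<eta>]) = abs_l32 (r @ [\<eta>])"
        using v'(2) True by (metis abs_l32_append append_Nil)
      ultimately show ?thesis using normal_form_cong by blast
    next
      case False
      then show ?thesis using *(4) v'(1) normal_form_table by (auto simp: xpows_def long_mids_def)
    qed
    ultimately show ?thesis using normal_form_cong by blast
  qed (use assms in auto)
  then have "normal_form (u @ r @ v @ [c])" by (rule normal_form_prepend[OF *(1)])
  then show ?thesis using w normal_form_cong by blast
qed

lemma nword_normal_form: "nword w \<Longrightarrow> normal_form w"
proof (induction w rule: rev_induct)
  case Nil
  show ?case by (rule normal_formI[of "[]" "[]" _ "[]"]) (auto simp: short_mids_def)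
next
  case (snoc c w)
  then show ?case by (cases c) (auto intro!: normal_form_snoc)
qed

text \<open>These are 7 * 3 * 7 + 7 * 3 = 168 words, the order of \<open>L_3(2)\<close>. As a list
  they allow statements about all of \<open>N\<close> to be checked by evaluation.\<close>

definition normal_forms :: "word list" where
  "normal_forms = [u @ r @ v. u \<leftarrow> xpows, r \<leftarrow> long_mids, v \<leftarrow> xpows] @
    [u @ r. u \<leftarrow> xpows, r \<leftarrow> short_mids]"

lemma nword_normal_forms:
  assumes "nword w"
  obtains l where "l \<in> set normal_forms" "w \<sim> l"
proof -
  obtain u r v where *: "xword u" "xword v" "abs_l32 w = abs_l32 (u @ r @ v)"
      "r \<in> set long_mids \<or> r \<in> set short_mids \<and> v = []"
    using nword_normal_form[OF assms] unfolding normal_form_def abs_l32_eq_iff by blast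
  obtain u' v' where uv: "u' \<in> set xpows" "abs_l32 u = abs_l32 u'" "v' \<in> set xpows" "abs_l32 v = abs_l32 v'"
    using xword_xpows *(1,2) by metis
  from *(4) show thesis
  proof (elim disjE conjE)
    assume r: "r \<in> set long_mids"
    show thesis
    proof (rule that)
      show "u' @ r @ v' \<in> set normal_forms" using r uv by (auto simp: normal_forms_def)
      show "w \<sim> u' @ r @ v'" unfolding abs_l32_eq_iff[symmetric] using *(3) uv by (simp add: abs_l32_append)
    qed
  next
    assume r: "r \<in> set short_mids" and v: "v = []"
    show thesis
    proof (rule that)
      show "u' @ r \<in> set normal_forms" using r uv by (auto simp: normal_forms_def)
      show "w \<sim> u' @ r" unfolding abs_l32_eq_iff[symmetric] using *(3) uv v by (simp add: abs_l32_append)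
    qed
  qed
qed

section \<open>The action of \<open>N\<close> on 14 points\<close>

text \<open>
  The point \<open>i\<close> of the paper is numbered \<open>i mod 7\<close> if \<open>i \<le> 7\<close> and \<open>7 + i mod 7\<close> otherwise; in particular
  \<open>t = t\<^sub>0\<close> here. The letter \<open>c\<close> maps \<open>i\<close> to the \<open>j\<close> with \<open>c t\<^sub>i c\<^sup>-\<^sup>1 = t\<^sub>j\<close>, which is the inverse of
  the right action of the paper. The letter \<open>t\<close> has no such action and gets the identity.
\<close>

fun point14 :: "bool \<times> gen \<Rightarrow> nat \<Rightarrow> nat" where
  "point14 (False, GX) i = [6, 0, 1, 2, 3, 4, 5, 13, 7, 8, 9, 10, 11, 12] ! i"
| "point14 (True, GX) i = [1, 2, 3, 4, 5, 6, 0, 8, 9, 10, 11, 12, 13, 7] ! i"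
| "point14 (_, GY) i = [0, 12, 3, 2, 11, 8, 13, 7, 5, 10, 9, 4, 1, 6] ! i"
| "point14 (_, GT) i = i"

definition letters :: word where
  "letters = [(b, g). b \<leftarrow> [False, True], g \<leftarrow> [GX, GY, GT]]"

lemma in_letters [simp]: "c \<in> set letters"
proof -
  have "(b, g) \<in> set letters" for b g by (cases b; cases g) (auto simp: letters_def)
  then show ?thesis by (cases c) auto
qed

lemma point14_check:
  "list_all (\<lambda>c. list_all (\<lambda>i. point14 c i < 14 \<and> point14 c (point14 (\<not> fst c, snd c) i) = i) [0..<14]) letters"
  by code_simp

lemma point14_less: "i < 14 \<Longrightarrow> point14 c i < 14"
  and point14_inverse: "i < 14 \<Longrightarrow> point14 (b, g) (point14 (\<not> b, g) i) = i"
  using point14_check[unfolded list_all_iff, rule_format, of c i]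
    point14_check[unfolded list_all_iff, rule_format, of "(b, g)" i] by auto

lemma act_point14_less: "i < 14 \<Longrightarrow> act point14 w i < 14"
  using act_closed[of "{..<14}" point14] point14_less by auto

lemma l32_act:
  assumes "u \<sim> v" "i < 14"
  shows "act point14 u i = act point14 v i"
proof (rule pres_eq_act[OF _ _ _ assms(1)])
  have "list_all (\<lambda>r. list_all (\<lambda>i. act point14 r i = i) [0..<14])
      [wpow wx 7, wpow wy 2, wpow (wx @ wy) 3, wpow (wcomm wx wy) 4]"
    by code_simp
  then show "\<And>r i. r \<in> L32_relators \<Longrightarrow> i \<in> {..<14} \<Longrightarrow> act point14 r i = i" 
    by (auto simp: L32_relators_def list_all_iff)
qed (use assms in \<open>auto simp: point14_less point14_inverse\<close>)

text \<open>Modulo 7 the 14 points become the points of a Fano plane, where 1, 2, 3 form a triangle;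
  an element of \<open>L_3(2)\<close> fixing a triangle is trivial.\<close>

lemma normal_forms_faithful:
  "list_all (\<lambda>l. act point14 l 1 mod 7 = 1 \<and> act point14 l 2 mod 7 = 2 \<and> act point14 l 3 mod 7 = 3 \<longrightarrow> l = []) normal_forms"
  by code_simp

section \<open>The fourteen conjugates of t\<close>

abbreviation tl ("\<tau>") where "\<tau> \<equiv> (False, GT)"

abbreviation G_eq (infix "\<approx>" 50) where "u \<approx> v \<equiv> pres_eq G_relators u v"

declare pe_trans [trans]

lemma l32_eq_G_eq: "u \<sim> v \<Longrightarrow> u \<approx> v"
  by (rule pres_eq_mono) (auto simp: L32_relators_def G_relators_def)

lemma nword_fixing_blocks:
  assumes "nword w" "act point14 w 1 mod 7 = 1" "act point14 w 2 mod 7 = 2" "act point14 w 3 mod 7 = 3"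
  shows "w \<sim> []"
proof -
  obtain l where l: "l \<in> set normal_forms" "w \<sim> l" using nword_normal_forms[OF assms(1)] .
  then have "l = []" using normal_forms_faithful assms l32_act[OF l(2)] by (auto simp: list_all_iff)
  then show ?thesis using l by simp
qed

lemma pres_eq_cancel:
  "pres_eq R (w @ winv w @ u) u" "pres_eq R (winv w @ w @ u) u"
  using pres_eq_append_right[OF pres_eq_winv_right, of R w u]
    pres_eq_append_right[OF pres_eq_winv_left, of R w u] by simp_all

text \<open>Turns equations between words in \<open>x\<close> and \<open>y\<close> into evaluations
  at three points; all later calculations with \<open>N\<close> rest on it.\<close>

lemma nword_eqI:
  assumes "nword u" "nword v" "map (act point14 u) [1, 2, 3] = map (act point14 v) [1, 2, 3]"
  shows "u \<approx> v"
proof -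
  have *: "act point14 (winv v) (act point14 v i) = i" if "i < 14" for i
    using l32_act[OF pres_eq_winv_left[of _ v] that] by simp
  have "winv v @ u \<sim> []"
    by (rule nword_fixing_blocks) (use assms *[of 1] *[of 2] *[of 3] in simp_all)
  then have "v @ winv v @ u \<sim> v @ []" by (rule pres_eq_append_left)
  then have "u \<sim> v" unfolding append_Nil2 by (rule pe_trans[OF pe_sym[OF pres_eq_cancel(1)]])
  then show ?thesis by (rule l32_eq_G_eq)
qed

section \<open>The stabiliser of the point 0 commutes with \<open>t\<close>\<close>

definition commutes :: "word \<Rightarrow> bool" where "commutes w \<longleftrightarrow> w @ [\<tau>] \<approx> [\<tau>] @ w"

lemma commutes_append:
  assumes "commutes u" "commutes v" shows "commutes (u @ v)"
proof -
  have "u @ (v @ [\<tau>]) \<approx> u @ ([\<tau>] @ v)"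
    using assms(2) unfolding commutes_def by (rule pres_eq_append_left)
  also have "\<dots> \<approx> ([\<tau>] @ u) @ v"
    using pres_eq_append_right[OF assms(1)[unfolded commutes_def], of v] by simp
  finally show ?thesis by (simp add: commutes_def)
qed

lemma commutes_concat: "(\<And>w. w \<in> set ws \<Longrightarrow> commutes w) \<Longrightarrow> commutes (concat ws)"
proof (induction ws)
  case (Cons w ws)
  then show ?case using commutes_append[of w "concat ws"] by simp
qed (simp add: commutes_def pe_refl)

lemma commutes_cong: "u \<approx> v \<Longrightarrow> commutes u \<Longrightarrow> commutes v"
  unfolding commutes_def by (meson pe_sym pe_trans pres_eq_append_left pres_eq_append_right)

lemma wcomm_trivial: "pres_eq R (wcomm u v) [] \<Longrightarrow> pres_eq R (u @ v) (v @ u)"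
proof -
  assume *: "pres_eq R (wcomm u v) []"
  have "pres_eq R (v @ u @ winv u @ winv v @ u @ v) (v @ winv v @ u @ v)"
    by (intro pres_eq_append_left pres_eq_cancel)
  then have "pres_eq R (v @ u @ wcomm u v) (u @ v)"
    unfolding wcomm_def by (auto intro: pe_trans pres_eq_cancel)
  moreover have "pres_eq R (v @ u @ wcomm u v) (v @ u @ [])"
    by (intro pres_eq_append_left *)
  ultimately show ?thesis by (metis append_Nil2 pe_sym pe_trans)
qed

lemma commutes_eta: "commutes [\<eta>]"
proof -
  have "wcomm wt wy \<approx> []" by (rule pres_eq_rel) (simp add: G_relators_def)
  from wcomm_trivial[OF this] show ?thesis unfolding commutes_def by (rule pe_sym)
qed

text \<open>Conjugation by \<open>x^2\<close> turns the first entry of the relator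
  \<open>[t^(x^2), y x^-1]\<close> back into \<open>t\<close> and the second into
  \<open>x^2 y x^-3\<close>.\<close>

lemma commutes_kappa: "commutes [\<xi>, \<xi>, \<eta>, \<xi>', \<xi>', \<xi>']"
proof -
  have "wcomm (wconj wt (wpow wx 2)) (wy @ winv wx) \<approx> []"
    by (rule pres_eq_rel) (simp add: G_relators_def)
  from wcomm_trivial[OF this]
  have *: "[\<xi>', \<xi>', \<tau>, \<xi>, \<xi>, \<eta>, \<xi>'] \<approx> [\<eta>, \<xi>', \<xi>', \<xi>', \<tau>, \<xi>, \<xi>]"
    by (simp add: wconj_def wpow_def numeral_eq_Suc)
  have cancel: "u @ [\<xi>, \<xi>, \<xi>', \<xi>'] @ v \<approx> u @ v" for u v
    using pres_eq_append_left[OF pres_eq_cancel(1)[of _ "[\<xi>, \<xi>]" v]] by simp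
  have "[\<tau>] @ [\<xi>, \<xi>, \<eta>, \<xi>', \<xi>', \<xi>'] \<approx> [\<xi>, \<xi>] @ [\<xi>', \<xi>', \<tau>, \<xi>, \<xi>, \<eta>, \<xi>'] @ [\<xi>', \<xi>']"
    using cancel[of "[]" "[\<tau>, \<xi>, \<xi>, \<eta>, \<xi>', \<xi>', \<xi>']"] by (auto intro: pe_sym)
  also have "\<dots> \<approx> [\<xi>, \<xi>] @ [\<eta>, \<xi>', \<xi>', \<xi>', \<tau>, \<xi>, \<xi>] @ [\<xi>', \<xi>']"
    by (intro pres_eq_append pe_refl *)
  also have "\<dots> \<approx> [\<xi>, \<xi>, \<eta>, \<xi>', \<xi>', \<xi>'] @ [\<tau>]"
    using cancel[of "[\<xi>, \<xi>, \<eta>, \<xi>', \<xi>', \<xi>', \<tau>]" "[]"] by simp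
  finally show ?thesis unfolding commutes_def by (rule pe_sym)
qed

text \<open>
  The stabiliser of the point 0 is an alternating group of degree 4, generated by the two words which the
  relators make commute with \<open>t\<close>.
\<close>

definition stab_words :: "word list" where
  "stab_words = map (\<lambda>bs. concat (map (\<lambda>b. if b then [\<xi>, \<xi>, \<eta>, \<xi>', \<xi>', \<xi>'] else [\<eta>]) bs))
    [[], [False], [True], [False, True], [True, False], [True, True], [False, True, False], [False, True, True], [True, False, True], [True, True, False], [True, False, True, True], [True, True, False, True]]"

lemma normal_forms_stab:
  "list_all (\<lambda>l. list_ex (\<lambda>s. map (act point14 s) [1, 2, 3] = map (act point14 l) [1, 2, 3]) stab_words)
    (filter (\<lambda>l. act point14 l 0 = 0) normal_forms)"
  by code_simp

lemma stab_words_commutes: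
  assumes "s \<in> set stab_words" shows "commutes s" "nword s"
proof -
  obtain bs where s: "s = concat (map (\<lambda>b. if b then [\<xi>, \<xi>, \<eta>, \<xi>', \<xi>', \<xi>'] else [\<eta>]) bs)"
    using assms unfolding stab_words_def set_map by (elim imageE)
  show "commutes s"
    unfolding s by (rule commutes_concat) (auto simp: commutes_eta commutes_kappa)
  show "nword s" unfolding s by (induction bs) auto
qed

text \<open>By evaluation, every normal form fixing 0 acts like one of the twelve products in
  \<open>stab_words\<close>, whose factors commute with \<open>t\<close>.\<close>

lemma stabilizer_commutes:
  assumes "nword h" "act point14 h 0 = 0"
  shows "commutes h"
proof -
  obtain l where l: "l \<in> set normal_forms" "h \<sim> l" using nword_normal_forms[OF assms(1)] .
  have "act point14 l 0 = 0" using assms(2) l32_act[OF l(2), of 0] by simp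
  then obtain s where s: "s \<in> set stab_words" "map (act point14 s) [1, 2, 3] = map (act point14 l) [1, 2, 3]"
    using normal_forms_stab l(1) unfolding list_all_iff list_ex_iff by auto
  have "s \<approx> h"
    by (rule nword_eqI) (use s assms stab_words_commutes(2) l32_act[OF l(2)] in simp_all)
  then show ?thesis using stab_words_commutes(1)[OF s(1)] commutes_cong by blast
qed

text \<open>A chosen word carrying 0 to \<open>i\<close>. Powers of \<open>x^-1\<close> step through
  0, ..., 6; \<open>y x^-1\<close> takes 0 to 12, and \<open>(i + 2) mod 7\<close> further steps
  lead from 12 to \<open>i\<close> in the cycle 7, ..., 13.\<close>

definition coset_word :: "nat \<Rightarrow> word" where
  "coset_word i = (if i < 7 then replicate i \<xi>' else replicate ((i + 2) mod 7) \<xi>' @ [\<eta>, \<xi>'])"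

definition t_word :: "nat \<Rightarrow> word" where "t_word i = coset_word i @ [\<tau>] @ winv (coset_word i)"

lemma nword_replicate [simp]: "nword (replicate n \<xi>')"
  by (induction n) auto

lemma nword_coset_word [simp]: "nword (coset_word i)"
  by (simp add: coset_word_def)

lemma act_coset_word: "i < 14 \<Longrightarrow> act point14 (coset_word i) 0 = i"
proof -
  have "list_all (\<lambda>i. act point14 (coset_word i) 0 = i) [0..<14]" by code_simp
  then show "i < 14 \<Longrightarrow> act point14 (coset_word i) 0 = i" by (auto simp: list_all_iff)
qed

lemma act_winv: "act point14 w i = j \<Longrightarrow> i < 14 \<Longrightarrow> act point14 (winv w) j = i"
  using l32_act[OF pres_eq_winv_left[of _ w], of i] by simp

text \<open>The word \<open>h\<close> leads from 0 to \<open>i\<close>, along \<open>w\<close> to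
  \<open>j\<close>, and back to 0. It fixes 0 and hence commutes with \<open>t\<close>, so
  \<open>w t_i w^-1\<close> depends on \<open>j\<close> only.\<close>

lemma t_word_equivariant:
  assumes "nword w" "i < 14"
  shows "w @ t_word i \<approx> t_word (act point14 w i) @ w"
proof -
  define j where "j = act point14 w i"
  have j: "j < 14" using act_point14_less assms j_def by simp
  define h where "h = winv (coset_word j) @ w @ coset_word i"
  have "commutes h"
    by (rule stabilizer_commutes) (use assms j in \<open>auto simp: h_def act_coset_word j_def intro!: act_winv\<close>)
  have "w @ coset_word i @ [\<tau>] @ winv (coset_word i) \<approx> (coset_word j @ winv (coset_word j) @ w @ coset_word i) @ [\<tau>] @ winv (coset_word i)"
    using pe_sym[OF pres_eq_cancel(1)[of G_relators "coset_word j" "w @ coset_word i @ [\<tau>] @ winv (coset_word i)"]] by simp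
  also have "\<dots> \<approx> coset_word j @ (h @ [\<tau>]) @ winv (coset_word i)" by (simp add: h_def pe_refl)
  also have "\<dots> \<approx> coset_word j @ ([\<tau>] @ h) @ winv (coset_word i)"
    using \<open>commutes h\<close> unfolding commutes_def by (intro pres_eq_append_left pres_eq_append_right)
  also have "\<dots> \<approx> (coset_word j @ [\<tau>] @ winv (coset_word j)) @ w @ coset_word i @ winv (coset_word i) @ []" by (simp add: h_def pe_refl)
  also have "\<dots> \<approx> (coset_word j @ [\<tau>] @ winv (coset_word j)) @ w @ []"
    by (intro pres_eq_append pe_refl pres_eq_cancel)
  finally show ?thesis by (simp add: t_word_def j_def)
qed

definition t_words :: "nat list \<Rightarrow> word" where "t_words l = concat (map t_word l)"

lemma t_words_simps [simp]: "t_words [] = []" "t_words (i # l) = t_word i @ t_words l" "t_words (u @ v) = t_words u @ t_words v"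
  by (simp_all add: t_words_def)

definition small :: "nat list \<Rightarrow> bool" where "small l \<longleftrightarrow> (\<forall>i\<in>set l. i < 14)"

lemma small_simps [simp]:
  "small []" "small (i # l) \<longleftrightarrow> i < 14 \<and> small l" "small (u @ v) \<longleftrightarrow> small u \<and> small v"
  "small (rev l) = small l" "small l \<Longrightarrow> small (map (act point14 w) l)"
  by (auto simp: small_def act_point14_less)

lemma t_words_equivariant: "nword w \<Longrightarrow> small l \<Longrightarrow> w @ t_words l \<approx> t_words (map (act point14 w) l) @ w"
proof (induction l)
  case (Cons i l)
  have "(w @ t_word i) @ t_words l \<approx> (t_word (act point14 w i) @ w) @ t_words l"
    using Cons.prems by (intro pres_eq_append_right t_word_equivariant) auto
  also have "\<dots> \<approx> t_word (act point14 w i) @ (t_words (map (act point14 w) l) @ w)"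
    using Cons by (simp add: pres_eq_append_left)
  finally show ?case by simp
qed (simp add: pe_refl)

lemma t_word_square: "t_word i @ t_word i \<approx> []"
proof -
  have "wpow wt 2 \<approx> []" by (rule pres_eq_rel) (simp add: G_relators_def)
  then have *: "[\<tau>] @ [\<tau>] \<approx> []" by (simp add: wpow_def numeral_eq_Suc)
  have "coset_word i @ [\<tau>] @ (winv (coset_word i) @ coset_word i @ [\<tau>] @ winv (coset_word i)) \<approx> coset_word i @ [\<tau>] @ ([\<tau>] @ winv (coset_word i))"
    by (intro pres_eq_append_left pres_eq_cancel)
  also have "\<dots> \<approx> coset_word i @ ([\<tau>] @ [\<tau>]) @ winv (coset_word i)" by (simp add: pe_refl)
  also have "\<dots> \<approx> coset_word i @ [] @ winv (coset_word i)" by (intro pres_eq_append pe_refl *)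
  also have "\<dots> \<approx> []" by (simp add: pres_eq_winv_right)
  finally show ?thesis by (simp add: t_word_def)
qed

lemma t_words_rev: "t_words (l @ rev l) \<approx> []"
proof (induction l)
  case (Cons i l)
  have "t_word i @ t_words (l @ rev l) @ t_word i \<approx> t_word i @ [] @ t_word i"
    by (intro pres_eq_append Cons.IH pe_refl)
  also have "\<dots> \<approx> []" using t_word_square by simp
  finally show ?case by simp
qed (simp add: pe_refl)

fun cancel_squares :: "nat list \<Rightarrow> nat list" where
  "cancel_squares [] = []"
| "cancel_squares (i # l) = (case cancel_squares l of [] \<Rightarrow> [i] | j # k \<Rightarrow> if i = j then k else i # j # k)"

lemma t_words_reduce: "t_words l \<approx> t_words (cancel_squares l)"
proof (induction l)
  case (Cons i l)
  have *: "t_words (i # l) \<approx> t_word i @ t_words (cancel_squares l)"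
    using Cons by (simp add: pres_eq_append_left)
  have "t_word i @ t_word i @ t_words k \<approx> t_words k" for k
    using pres_eq_append_right[OF t_word_square, of i "t_words k"] by simp
  then show ?case using * by (auto split: list.split intro: pe_trans)
qed (simp add: pe_refl)

section \<open>Relations between the conjugates of t\<close>

definition t_relation :: "nat list \<Rightarrow> word \<Rightarrow> bool" where
  "t_relation l m \<longleftrightarrow> small l \<and> nword m \<and> t_words l @ m \<approx> []"

definition t_rule :: "nat list \<Rightarrow> nat list \<Rightarrow> word \<Rightarrow> bool" where
  "t_rule u v m \<longleftrightarrow> small u \<and> small v \<and> nword m \<and> t_words u \<approx> t_words v @ m"

text \<open>One rewriting step modulo \<open>N\<close>: the rule is conjugated by \<open>g\<close>
  and applied inside \<open>l\<close>; its part \<open>g m g^-1\<close> in \<open>N\<close> is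
  pushed to the right end, permuting the indices in \<open>b\<close> on the way. The list equations
  are evaluations, and \<open>w'\<close> may be any word in \<open>x\<close> and \<open>y\<close>
  with the right images of 1, 2, 3.\<close>

lemma t_rule_step:
  assumes "t_rule u v m" "nword g" "small b" "nword w" "nword w'"
    and "l = a @ map (act point14 g) u @ b"
    and "l' = cancel_squares (a @ map (act point14 g) v @ map (act point14 (g @ m @ winv g)) b)"
    and "map (act point14 (g @ m @ winv g @ w)) [1, 2, 3] = map (act point14 w') [1, 2, 3]"
  shows "t_words l @ w \<approx> t_words l' @ w'"
proof -
  have m: "nword m" "small u" "small v" "t_words u \<approx> t_words v @ m" using assms(1) by (auto simp: t_rule_def)
  define c where "c = g @ m @ winv g"
  have c: "nword c" using m assms by (simp add: c_def)
  have "t_words (map (act point14 g) u) \<approx> t_words (map (act point14 g) u) @ g @ winv g"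
    using pres_eq_append_left[OF pres_eq_winv_right] by (metis append_Nil2 pe_sym)
  also have "\<dots> \<approx> (g @ t_words u) @ winv g"
    using t_words_equivariant[OF assms(2) m(2), THEN pe_sym] pres_eq_append_right by fastforce
  also have "\<dots> \<approx> (g @ t_words v @ m) @ winv g"
    by (intro pres_eq_append pe_refl m)
  also have "\<dots> \<approx> (t_words (map (act point14 g) v) @ g) @ m @ winv g"
    using pres_eq_append_right[OF t_words_equivariant[OF assms(2) m(3)], of "m @ winv g"] by simp
  finally have *: "t_words (map (act point14 g) u) \<approx> t_words (map (act point14 g) v) @ c" by (simp add: c_def)
  have "t_words l @ w \<approx> t_words a @ (t_words (map (act point14 g) u)) @ t_words b @ w"
    by (simp add: assms(6) pe_refl)
  also have "\<dots> \<approx> t_words a @ (t_words (map (act point14 g) v) @ c) @ t_words b @ w"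
    by (intro pres_eq_append pe_refl *)
  also have "\<dots> \<approx> t_words a @ t_words (map (act point14 g) v) @ (c @ t_words b) @ w" by (simp add: pe_refl)
  also have "\<dots> \<approx> t_words a @ t_words (map (act point14 g) v) @ (t_words (map (act point14 c) b) @ c) @ w"
    by (intro pres_eq_append pe_refl t_words_equivariant c assms)
  also have "\<dots> \<approx> t_words (a @ map (act point14 g) v @ map (act point14 c) b) @ (c @ w)" by (simp add: pe_refl)
  also have "\<dots> \<approx> t_words l' @ w'"
    unfolding assms(7) c_def[symmetric]
    by (intro pres_eq_append t_words_reduce nword_eqI) (use assms m in \<open>auto simp: c_def\<close>)
  finally show ?thesis .
qed

text \<open>A critical pair: if one word equals both \<open>u m\<close> and \<open>v m'\<close>,
  then \<open>u m m'^-1 v^-1 = 1\<close>. Since the \<open>t_i\<close> are involutions,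
  \<open>v^-1\<close> is \<open>v\<close> reversed; \<open>c\<close> stands for
  \<open>m m'^-1\<close>.\<close>

lemma t_relationI:
  assumes "t_words u0 @ w0 \<approx> t_words u @ m" "t_words u0 @ w0 \<approx> t_words v @ m'"
    "nword m" "nword m'" "nword c" "small u" "small v"
    "l = cancel_squares (u @ map (act point14 c) (rev v))"
    "map (act point14 (m @ winv m')) [1, 2, 3] = map (act point14 c) [1, 2, 3]"
  shows "t_relation l c"
proof -
  have small: "small (cancel_squares k)" if "small k" for k
    using that by (induction k) (auto split: list.splits)
  have "t_words l @ c \<approx> t_words (u @ map (act point14 c) (rev v)) @ c"
    unfolding assms by (intro pres_eq_append_right pe_sym[OF t_words_reduce])
  also have "\<dots> \<approx> t_words u @ (c @ t_words (rev v))"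
    using t_words_equivariant[of c "rev v", THEN pe_sym] assms by (simp add: pres_eq_append_left)
  also have "\<dots> \<approx> t_words u @ (m @ winv m') @ t_words (rev v)"
    by (intro pres_eq_append pe_refl nword_eqI) (use assms in auto)
  also have "\<dots> \<approx> (t_words u @ m) @ (winv m' @ t_words (rev v))" by (simp add: pe_refl)
  also have "\<dots> \<approx> (t_words v @ m') @ (winv m' @ t_words (rev v))"
    using assms(1,2) by (intro pres_eq_append_right) (blast intro: pe_sym pe_trans)
  also have "\<dots> \<approx> t_words v @ t_words (rev v)"
    by (simp add: pres_eq_append_left pres_eq_cancel)
  also have "\<dots> \<approx> []" using t_words_rev by simp
  finally show ?thesis using assms by (simp add: t_relation_def small)
qed

lemma t_relation_rotate:
  assumes "t_relation (a @ b) m" shows "t_relation (b @ map (act point14 m) a) m"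
proof -
  have *: "small a" "small b" "nword m" "t_words a @ t_words b @ m \<approx> []" using assms by (auto simp: t_relation_def)
  have "t_words (b @ map (act point14 m) a) @ m \<approx> t_words b @ m @ t_words a"
    using t_words_equivariant[OF *(3,1), THEN pe_sym] by (simp add: pres_eq_append_left)
  also have "\<dots> \<approx> winv (t_words a) @ t_words a @ t_words b @ m @ t_words a"
    by (rule pe_sym[OF pres_eq_cancel(2)])
  also have "\<dots> \<approx> winv (t_words a) @ [] @ t_words a"
    using pres_eq_append_left[OF pres_eq_append_right[OF *(4)]] by fastforce
  also have "\<dots> \<approx> []" by (simp add: pres_eq_winv_left)
  finally show ?thesis using * by (simp add: t_relation_def)
qed

text \<open>Rotated to start with \<open>u\<close>, the relation reads \<open>u = (v m)^-1\<close>,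
  that is \<open>m^-1\<close> times \<open>v\<close> reversed. Moving \<open>m^-1\<close>, for which
  \<open>m'\<close> is a convenient word, to the right permutes the indices.\<close>

lemma t_relation_rule:
  assumes "t_relation l m" "l = a @ b" "b @ map (act point14 m) a = u @ v"
    and "nword m'" "v' = map (act point14 m') (rev v)"
    and "map (act point14 (winv m)) [1, 2, 3] = map (act point14 m') [1, 2, 3]"
  shows "t_rule u v' m'"
proof -
  have "t_relation (u @ v) m" using assms(1-3) t_relation_rotate by metis
  then have *: "small u" "small v" "nword m" "t_words u @ t_words v @ m \<approx> []" by (auto simp: t_relation_def)
  have "t_words u \<approx> t_words u @ t_words (v @ rev v)"
    using pres_eq_append_left[OF t_words_rev] by (metis append_Nil2 pe_sym)
  also have "\<dots> \<approx> (t_words u @ t_words v) @ (m @ winv m @ t_words (rev v))"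
    using pres_eq_append_left[OF pe_sym[OF pres_eq_cancel(1)[of _ m "t_words (rev v)"]], where w = "t_words u @ t_words v"] by simp
  also have "\<dots> \<approx> (t_words u @ t_words v @ m) @ (winv m @ t_words (rev v))" by (simp add: pe_refl)
  also have "\<dots> \<approx> [] @ (winv m @ t_words (rev v))" by (intro pres_eq_append_right *)
  also have "\<dots> \<approx> m' @ t_words (rev v)"
    unfolding append_Nil by (intro pres_eq_append_right nword_eqI) (use * assms in auto)
  also have "\<dots> \<approx> t_words v' @ m'"
    unfolding assms(5) by (rule t_words_equivariant) (use * assms in auto)
  finally show ?thesis using * assms by (simp add: t_rule_def)
qed

text \<open>The list \<open>n i, n^2 i, ..., n^k i\<close>, which occurs because
  \<open>(n t_i)^k\<close> equals the product of the corresponding conjugates times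
  \<open>n^k\<close>.\<close>

primrec orbit :: "word \<Rightarrow> nat \<Rightarrow> nat \<Rightarrow> nat list" where
  "orbit n i 0 = []"
| "orbit n i (Suc k) = map (act point14 n) (i # orbit n i k)"

lemma wpow_t_word:
  assumes "nword n" "i < 14"
  shows "small (orbit n i k) \<and> nword (wpow n k) \<and> wpow (n @ t_word i) k \<approx> t_words (orbit n i k) @ wpow n k"
proof (induction k)
  case (Suc k)
  have s: "small (i # orbit n i k)" using Suc assms by simp
  have "(n @ t_word i) @ wpow (n @ t_word i) k \<approx> (n @ t_word i) @ t_words (orbit n i k) @ wpow n k"
    using Suc by (intro pres_eq_append_left) auto
  also have "\<dots> \<approx> (n @ t_words (i # orbit n i k)) @ wpow n k" by (simp add: pe_refl)
  also have "\<dots> \<approx> (t_words (map (act point14 n) (i # orbit n i k)) @ n) @ wpow n k"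
    by (intro pres_eq_append_right t_words_equivariant assms s)
  finally show ?case using assms Suc s by (simp add: wpow_def act_point14_less)
qed (auto simp: wpow_def pe_refl)

lemma t_relation_power:
  assumes "wpow (n @ t_word i) k \<approx> []" "nword n" "i < 14"
  shows "t_relation (orbit n i k) (wpow n k)"
  using wpow_t_word[OF assms(2,3), of k] assms(1) unfolding t_relation_def by (blast intro: pe_sym pe_trans)

section \<open>Consequences of the relators of exponent 5\<close>

lemma orbit_5: "orbit n i 5 = map (act point14 n) (i # map (act point14 n) (i # map (act point14 n)
    (i # map (act point14 n) (i # map (act point14 n) [i]))))"
  by (simp add: eval_nat_numeral)

lemma wpow_2: "wpow w 2 = w @ w" and wpow_5: "wpow w 5 = w @ w @ w @ w @ w"
  by (simp_all add: wpow_def eval_nat_numeral)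

lemma t_word_1: "t_word 1 = wconj wt wx" and t_word_2: "t_word 2 = wconj wt (wpow wx 2)"
  by (simp_all add: t_word_def coset_word_def wconj_def wpow_def numeral_2_eq_2)

text \<open>The involutions \<open>y\<close> and \<open>t_2\<close> have a product with fifth power
  1. As \<open>y\<close> swaps 2 and 3, that power is \<open>t_3 t_2 t_3 t_2 t_3 y\<close>.\<close>

lemma t_rule_dihedral: "t_rule [3, 2, 3] [2, 3] [\<eta>]"
proof -
  have "wpow (wy @ wconj wt (wpow wx 2)) 5 \<approx> []" by (rule pres_eq_rel) (simp add: G_relators_def)
  then have "t_relation (orbit wy 2 5) (wpow wy 5)"
    unfolding t_word_2[symmetric] by (rule t_relation_power) simp_all
  then show ?thesis
    by (rule t_relation_rule[where a = "[]" and b = "[3, 2, 3, 2, 3]" and v = "[2, 3]"]) (simp_all add: orbit_5 wpow_5)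
qed

text \<open>The word \<open>x y x^2\<close> permutes 1, 12, 8, 5 cyclically, so the fifth power of
  \<open>x y x^2 t_1\<close> has the indices 12, 8, 5, 1, 12. The part in \<open>N\<close> is the
  inverse of \<open>x y x^2\<close>, whose fourth power is 1.\<close>

lemma t_rule_4cycle: "t_rule [12, 8, 5] [1, 5] [\<xi>', \<xi>', \<eta>, \<xi>']"
proof -
  let ?n = "wx @ wy @ wpow wx 2"
  have "wpow (wx @ wy @ wpow wx 2 @ wconj wt wx) 5 \<approx> []" by (rule pres_eq_rel) (simp add: G_relators_def)
  then have "wpow (?n @ t_word 1) 5 \<approx> []" unfolding t_word_1 by simp
  then have "t_relation (orbit ?n 1 5) (wpow ?n 5)"
    by (rule t_relation_power) (simp_all add: wpow_2)
  then show ?thesis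
    by (rule t_relation_rule[where a = "[]" and b = "[12, 8, 5, 1, 12]" and v = "[1, 12]"])
      (simp_all add: orbit_5 wpow_5 wpow_2)
qed

text \<open>
  The relations up to \<open>t_words_line\<close> come from a Knuth--Bendix completion modulo conjugation by \<open>N\<close>:
  each of them compares the two ways in which earlier rules rewrite one overlap.
\<close>

lemma t_relation_6: "t_relation [9, 2, 8, 2, 9, 1] [\<eta>, \<xi>, \<xi>, \<xi>, \<eta>, \<xi>, \<xi>, \<xi>]"
proof -
  have 1: "t_words [1, 2, 8, 9, 8] @ [] \<approx> t_words [9, 2] @ [\<xi>, \<eta>, \<xi>', \<xi>', \<xi>', \<eta>, \<xi>, \<xi>]"
    by (rule t_rule_step[OF t_rule_4cycle,
        where g = "[\<eta>, \<xi>', \<xi>', \<eta>, \<xi>, \<xi>, \<xi>]" and a = "[]" and b = "[9, 8]"]) simp_all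
  have 2: "t_words [1, 2, 8, 9, 8] @ [] \<approx> t_words [1, 2, 9, 8] @ [\<xi>, \<eta>, \<xi>']"
    by (rule t_rule_step[OF t_rule_dihedral,
        where g = "[\<eta>, \<xi>, \<xi>, \<eta>, \<xi>, \<xi>, \<eta>]" and a = "[1, 2]" and b = "[]"]) simp_all
  show ?thesis
    by (rule t_relationI[OF 1 2]) simp_all
qed

text \<open>Reading \<open>t_relation_6\<close> from different starting points gives this rule, its
  reverse \<open>t_rule_6b\<close>, and two rules shortening four letters to two. All four share one
  part in \<open>N\<close>, since \<open>(y x^3)^2\<close> is its own inverse.\<close>

lemma t_rule_6a: "t_rule [9, 2, 8] [1, 2, 9] [\<eta>, \<xi>, \<xi>, \<xi>, \<eta>, \<xi>, \<xi>, \<xi>]"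
  by (rule t_relation_rule[OF t_relation_6,
        where a = "[]" and b = "[9, 2, 8, 2, 9, 1]" and v = "[2, 9, 1]"]) simp_all

lemma t_rule_6b: "t_rule [1, 2, 9] [9, 2, 8] [\<eta>, \<xi>, \<xi>, \<xi>, \<eta>, \<xi>, \<xi>, \<xi>]"
  by (rule t_relation_rule[OF t_relation_6,
        where a = "[9, 2, 8, 2, 9]" and b = "[1]" and v = "[8, 9, 2]"]) simp_all

lemma t_rule_6c: "t_rule [2, 9, 1, 2] [8, 2] [\<eta>, \<xi>, \<xi>, \<xi>, \<eta>, \<xi>, \<xi>, \<xi>]"
  by (rule t_relation_rule[OF t_relation_6,
        where a = "[9, 2, 8]" and b = "[2, 9, 1]" and v = "[9, 8]"]) simp_all

lemma t_rule_6d: "t_rule [1, 2, 9, 8] [9, 2] [\<eta>, \<xi>, \<xi>, \<xi>, \<eta>, \<xi>, \<xi>, \<xi>]"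
  by (rule t_relation_rule[OF t_relation_6,
        where a = "[9, 2, 8, 2, 9]" and b = "[1]" and v = "[9, 2]"]) simp_all

lemma t_relation_1_8: "t_relation [1, 8, 1, 8] []"
proof -
  \<comment> \<open>In this overlap \<open>t_rule_6d\<close> applies to the first four letters and
    \<open>t_rule_dihedral\<close> to the last three. Both reductions end in \<open>t_2\<close> and
    the same part in \<open>N\<close>, which leaves \<open>t_1 t_8 t_1 = t_8\<close>.\<close>
  have 1: "t_words [9, 8, 1, 2, 8, 2] @ [] \<approx> t_words [1, 8, 1, 2] @ [\<xi>', \<xi>', \<eta>, \<xi>, \<xi>]"
    by (rule t_rule_step[OF t_rule_6d,
        where g = "[\<xi>, \<xi>, \<eta>, \<xi>, \<xi>, \<xi>, \<eta>, \<xi>]" and a = "[]" and b = "[8, 2]"]) simp_all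
  have "t_words [9, 8, 1, 2, 8, 2] @ [] \<approx> t_words [9, 8, 1, 8, 2] @ [\<xi>, \<xi>, \<eta>, \<xi>, \<xi>, \<xi>, \<eta>, \<xi>]"
    by (rule t_rule_step[OF t_rule_dihedral,
        where g = "[\<xi>', \<xi>', \<eta>, \<xi>, \<xi>, \<xi>]" and a = "[9, 8, 1]" and b = "[]"]) simp_all
  also have "\<dots> \<approx> t_words [9, 8, 9, 8, 1] @ [\<xi>, \<eta>, \<xi>', \<xi>', \<xi>', \<eta>, \<xi>, \<xi>]"
    by (rule t_rule_step[OF t_rule_6a,
        where g = "[\<xi>, \<xi>, \<eta>, \<xi>, \<xi>, \<xi>, \<eta>, \<xi>]" and a = "[9, 8]" and b = "[]"]) simp_all
  also have "\<dots> \<approx> t_words [8, 2] @ [\<xi>', \<xi>', \<eta>, \<xi>, \<xi>]"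
    by (rule t_rule_step[OF t_rule_dihedral,
        where g = "[\<eta>, \<xi>, \<xi>, \<eta>, \<xi>, \<xi>]" and a = "[]" and b = "[8, 1]"]) simp_all
  finally have 2: "t_words [9, 8, 1, 2, 8, 2] @ [] \<approx> t_words [8, 2] @ [\<xi>', \<xi>', \<eta>, \<xi>, \<xi>]" .
  show ?thesis
    by (rule t_relationI[OF 1 2]) simp_all
qed

lemma t_rule_1_8: "t_rule [1, 8] [8, 1] []"
  by (rule t_relation_rule[OF t_relation_1_8,
        where a = "[]" and b = "[1, 8, 1, 8]" and v = "[1, 8]"]) simp_all

lemma t_rule_8_1: "t_rule [8, 1] [1, 8] []"
  by (rule t_relation_rule[OF t_relation_1_8,
        where a = "[1]" and b = "[8, 1, 8]" and v = "[8, 1]"]) simp_all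

lemma t_relation_5a: "t_relation [4, 5, 9, 4, 5] [\<xi>, \<xi>, \<eta>, \<xi>', \<xi>', \<eta>, \<xi>]"
proof -
  \<comment> \<open>Here and in \<open>t_relation_5b\<close>, \<open>t_rule_6d\<close> on the first
    four letters overlaps with \<open>t_rule_6c\<close> on the last four.\<close>
  have "t_words [9, 8, 1, 2, 9, 5, 2] @ [] \<approx> t_words [1, 8, 9, 4, 2] @ [\<xi>', \<xi>', \<eta>, \<xi>, \<xi>]"
    by (rule t_rule_step[OF t_rule_6d,
        where g = "[\<xi>, \<xi>, \<eta>, \<xi>, \<xi>, \<xi>, \<eta>, \<xi>]" and a = "[]" and b = "[9, 5, 2]"]) simp_all
  also have "\<dots> \<approx> t_words [8, 1, 9, 4, 2] @ [\<xi>', \<xi>', \<eta>, \<xi>, \<xi>]"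
    by (rule t_rule_step[OF t_rule_1_8,
        where g = "[]" and a = "[]" and b = "[9, 4, 2]"]) simp_all
  also have "\<dots> \<approx> t_words [8, 1, 11, 2] @ [\<xi>', \<eta>]"
    by (rule t_rule_step[OF t_rule_4cycle,
        where g = "[\<xi>', \<eta>, \<xi>, \<xi>, \<xi>, \<eta>]" and a = "[8, 1]" and b = "[]"]) simp_all
  also have "\<dots> \<approx> t_words [1, 8, 11, 2] @ [\<xi>', \<eta>]"
    by (rule t_rule_step[OF t_rule_8_1,
        where g = "[]" and a = "[]" and b = "[11, 2]"]) simp_all
  also have "\<dots> \<approx> t_words [4, 8, 1, 12] @ [\<xi>, \<xi>, \<xi>, \<eta>, \<xi>, \<xi>, \<xi>, \<eta>]"
    by (rule t_rule_step[OF t_rule_6a,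
        where g = "[\<eta>, \<xi>, \<xi>, \<eta>, \<xi>, \<xi>]" and a = "[]" and b = "[2]"]) simp_all
  also have "\<dots> \<approx> t_words [4, 5, 1, 8] @ [\<xi>, \<xi>, \<eta>, \<xi>', \<xi>']"
    by (rule t_rule_step[OF t_rule_6a,
        where g = "[\<eta>, \<xi>, \<xi>, \<xi>, \<eta>, \<xi>', \<xi>', \<xi>']" and a = "[4]" and b = "[]"]) simp_all
  finally have 1: "t_words [9, 8, 1, 2, 9, 5, 2] @ [] \<approx> t_words [4, 5, 1, 8] @ [\<xi>, \<xi>, \<eta>, \<xi>', \<xi>']" .
  have "t_words [9, 8, 1, 2, 9, 5, 2] @ [] \<approx> t_words [9, 8, 1, 12, 2] @ [\<xi>, \<xi>, \<eta>, \<xi>', \<xi>']"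
    by (rule t_rule_step[OF t_rule_6c,
        where g = "[\<eta>, \<xi>', \<xi>', \<xi>', \<eta>, \<xi>, \<xi>, \<eta>, \<xi>']" and a = "[9, 8, 1]" and b = "[]"]) simp_all
  also have "\<dots> \<approx> t_words [9, 1, 8, 12, 2] @ [\<xi>, \<xi>, \<eta>, \<xi>', \<xi>']"
    by (rule t_rule_step[OF t_rule_8_1,
        where g = "[]" and a = "[9]" and b = "[12, 2]"]) simp_all
  also have "\<dots> \<approx> t_words [9, 5, 8, 1, 11] @ [\<xi>, \<xi>, \<xi>, \<eta>, \<xi>, \<xi>, \<xi>, \<eta>]"
    by (rule t_rule_step[OF t_rule_6a,
        where g = "[\<xi>, \<xi>, \<eta>, \<xi>, \<xi>, \<eta>, \<xi>', \<xi>']" and a = "[9]" and b = "[2]"]) simp_all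
  also have "\<dots> \<approx> t_words [9, 5, 4, 1, 8] @ [\<xi>', \<eta>]"
    by (rule t_rule_step[OF t_rule_6a,
        where g = "[\<eta>, \<xi>, \<xi>, \<xi>, \<eta>, \<xi>', \<xi>', \<eta>]" and a = "[9, 5]" and b = "[]"]) simp_all
  finally have 2: "t_words [9, 8, 1, 2, 9, 5, 2] @ [] \<approx> t_words [9, 5, 4, 1, 8] @ [\<xi>', \<eta>]" .
  show ?thesis
    by (rule t_relationI[OF 1 2]) simp_all
qed

lemma t_rule_5a: "t_rule [4, 5, 9] [9, 5] [\<xi>', \<eta>, \<xi>, \<xi>, \<eta>, \<xi>', \<xi>']"
  by (rule t_relation_rule[OF t_relation_5a,
        where a = "[]" and b = "[4, 5, 9, 4, 5]" and v = "[4, 5]"]) simp_all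

lemma t_relation_5b: "t_relation [7, 3, 9, 7, 3] [\<xi>, \<eta>, \<xi>', \<xi>']"
proof -
  have "t_words [9, 8, 1, 2, 9, 3, 2] @ [] \<approx> t_words [1, 8, 9, 7, 2] @ [\<xi>', \<xi>', \<eta>, \<xi>, \<xi>]"
    by (rule t_rule_step[OF t_rule_6d,
        where g = "[\<xi>, \<xi>, \<eta>, \<xi>, \<xi>, \<xi>, \<eta>, \<xi>]" and a = "[]" and b = "[9, 3, 2]"]) simp_all
  also have "\<dots> \<approx> t_words [8, 1, 9, 7, 2] @ [\<xi>', \<xi>', \<eta>, \<xi>, \<xi>]"
    by (rule t_rule_step[OF t_rule_1_8,
        where g = "[]" and a = "[]" and b = "[9, 7, 2]"]) simp_all
  also have "\<dots> \<approx> t_words [8, 1, 0, 2] @ [\<eta>, \<xi>, \<eta>, \<xi>', \<xi>', \<eta>]"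
    by (rule t_rule_step[OF t_rule_4cycle,
        where g = "[\<xi>, \<eta>, \<xi>', \<xi>', \<xi>', \<eta>, \<xi>, \<xi>, \<eta>]" and a = "[8, 1]" and b = "[]"]) simp_all
  also have "\<dots> \<approx> t_words [7, 1, 8, 10] @ [\<eta>, \<xi>', \<xi>', \<eta>, \<xi>, \<xi>, \<eta>]"
    by (rule t_rule_step[OF t_rule_6a,
        where g = "[\<xi>', \<eta>, \<xi>, \<xi>]" and a = "[]" and b = "[2]"]) simp_all
  also have "\<dots> \<approx> t_words [7, 3, 8, 1] @ [\<xi>', \<xi>', \<xi>', \<eta>, \<xi>, \<xi>, \<xi>]"
    by (rule t_rule_step[OF t_rule_6a,
        where g = "[\<xi>', \<xi>', \<xi>', \<eta>, \<xi>]" and a = "[7]" and b = "[]"]) simp_all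
  finally have 1: "t_words [9, 8, 1, 2, 9, 3, 2] @ [] \<approx> t_words [7, 3, 8, 1] @ [\<xi>', \<xi>', \<xi>', \<eta>, \<xi>, \<xi>, \<xi>]" .
  have "t_words [9, 8, 1, 2, 9, 3, 2] @ [] \<approx> t_words [9, 8, 1, 10, 2] @ [\<xi>', \<xi>', \<xi>', \<eta>, \<xi>, \<xi>, \<xi>]"
    by (rule t_rule_step[OF t_rule_6c,
        where g = "[\<eta>, \<xi>']" and a = "[9, 8, 1]" and b = "[]"]) simp_all
  also have "\<dots> \<approx> t_words [9, 3, 1, 8, 0] @ [\<eta>, \<xi>', \<xi>', \<eta>, \<xi>, \<xi>, \<eta>]"
    by (rule t_rule_step[OF t_rule_6a,
        where g = "[\<xi>, \<xi>, \<eta>, \<xi>', \<xi>', \<eta>, \<xi>, \<xi>]" and a = "[9]" and b = "[2]"]) simp_all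
  also have "\<dots> \<approx> t_words [9, 3, 7, 8, 1] @ [\<eta>, \<xi>, \<eta>, \<xi>', \<xi>', \<eta>]"
    by (rule t_rule_step[OF t_rule_6a,
        where g = "[\<eta>, \<xi>', \<xi>', \<eta>]" and a = "[9, 3]" and b = "[]"]) simp_all
  finally have 2: "t_words [9, 8, 1, 2, 9, 3, 2] @ [] \<approx> t_words [9, 3, 7, 8, 1] @ [\<eta>, \<xi>, \<eta>, \<xi>', \<xi>', \<eta>]" .
  show ?thesis
    by (rule t_relationI[OF 1 2]) simp_all
qed

lemma t_rule_5b: "t_rule [3, 9, 7] [7, 9] [\<xi>, \<xi>, \<eta>, \<xi>']"
  by (rule t_relation_rule[OF t_relation_5b,
        where a = "[7]" and b = "[3, 9, 7, 3]" and v = "[3, 9]"]) simp_all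

text \<open>This is \<open>s_1 s_2 s_6 = 1\<close>, spelled out as the pairs \<open>i, i + 7\<close>
  over the line {1, 2, 6}.\<close>

lemma t_words_line: "t_words [1, 8, 2, 9, 6, 13] \<approx> []"
proof -
  have "t_words [1, 8, 2, 9, 6, 13] @ [] \<approx> t_words [1, 9, 2, 1, 13, 6] @ [\<eta>, \<xi>, \<xi>, \<xi>, \<eta>, \<xi>, \<xi>, \<xi>]"
    by (rule t_rule_step[OF t_rule_6b,
        where g = "[\<xi>', \<xi>', \<eta>, \<xi>, \<xi>]" and a = "[1]" and b = "[6, 13]"]) simp_all
  also have "\<dots> \<approx> t_words [1, 9, 13, 1, 9] @ [\<eta>, \<xi>', \<xi>', \<eta>, \<xi>, \<eta>]"
    by (rule t_rule_step[OF t_rule_5a,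
        where g = "[\<xi>, \<eta>, \<xi>, \<xi>]" and a = "[1, 9]" and b = "[6]"]) simp_all
  also have "\<dots> \<approx> t_words [] @ []"
    by (rule t_rule_step[OF t_rule_5b,
        where g = "[\<xi>, \<eta>]" and a = "[]" and b = "[1, 9]"]) simp_all
  finally show ?thesis by (simp add: t_words_def)
qed

section \<open>Blocks of imprimitivity \<open>{i, i + 7}\<close>\<close>

lemma point14_mod: "i < 14 \<Longrightarrow> point14 c ((i + 7) mod 14) = (point14 c i + 7) mod 14"
proof -
  have "list_all (\<lambda>c. list_all (\<lambda>i. point14 c ((i + 7) mod 14) = (point14 c i + 7) mod 14) [0..<14]) letters"
    by code_simp
  then show "i < 14 \<Longrightarrow> point14 c ((i + 7) mod 14) = (point14 c i + 7) mod 14"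
    by (auto simp: list_all_iff)
qed

lemma act_point14_partner: "i < 14 \<Longrightarrow> act point14 w ((i + 7) mod 14) = (act point14 w i + 7) mod 14"
  by (induction w) (simp_all add: point14_mod act_point14_less)

lemma act_point14_mod: "i < 14 \<Longrightarrow> act point14 w (i mod 7) mod 7 = act point14 w i mod 7"
proof (cases "i < 7")
  case False
  moreover assume "i < 14"
  ultimately have i: "i mod 7 = i - 7" "i - 7 < 14" "(i - 7 + 7) mod 14 = i" by (auto simp: mod_if)
  then show ?thesis using act_point14_partner[of "i - 7" w] act_point14_less[of "i - 7" w] by (auto simp: mod_if)
qed simp

lemma pres_eq_cancel_right: "pres_eq R (u @ w) (v @ w) \<Longrightarrow> pres_eq R u v"
proof -
  assume "pres_eq R (u @ w) (v @ w)"
  then have "pres_eq R (u @ w @ winv w) (v @ w @ winv w)"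
    using pres_eq_append_right[of R "u @ w" "v @ w" "winv w"] by simp
  moreover have "pres_eq R (z @ w @ winv w) z" for z
    using pres_eq_append_left[OF pres_eq_winv_right, of R z w] by simp
  ultimately show ?thesis by (blast intro: pe_sym pe_trans)
qed

lemma t_words_conj_eq:
  assumes "t_words k \<approx> t_words l" "nword w" "small k" "small l"
  shows "t_words (map (act point14 w) k) \<approx> t_words (map (act point14 w) l)"
proof (rule pres_eq_cancel_right)
  have "t_words (map (act point14 w) k) @ w \<approx> w @ t_words k" by (rule pe_sym[OF t_words_equivariant]) (use assms in auto)
  also have "\<dots> \<approx> w @ t_words l" by (rule pres_eq_append_left[OF assms(1)])
  also have "\<dots> \<approx> t_words (map (act point14 w) l) @ w" by (rule t_words_equivariant) (use assms in auto)
  finally show "t_words (map (act point14 w) k) @ w \<approx> t_words (map (act point14 w) l) @ w" .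
qed

section \<open>The elementary abelian subgroup\<close>

definition s_word :: "nat \<Rightarrow> word" where "s_word i = t_word i @ t_word (i + 7)"

lemma t_word_commute: "i < 7 \<Longrightarrow> t_word (i + 7) @ t_word i \<approx> s_word i"
proof -
  assume i: "i < 7"
  \<comment> \<open>\<open>x\<close> takes 1 to 0 and \<open>coset_word i\<close> takes 0 to
    \<open>i\<close>; the partner 8 then goes to \<open>i + 7\<close>.\<close>
  have "act point14 (coset_word i @ [\<xi>]) 1 = i" using i by (simp add: act_coset_word)
  moreover from this have "act point14 (coset_word i @ [\<xi>]) 8 = i + 7"
    using act_point14_partner[of 1 "coset_word i @ [\<xi>]"] i by simp
  moreover have "t_words [8, 1] \<approx> t_words [1, 8]" using t_rule_8_1 by (simp add: t_rule_def)
  from t_words_conj_eq[OF this, of "coset_word i @ [\<xi>]"]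
  have "t_words (map (act point14 (coset_word i @ [\<xi>])) [8, 1]) \<approx> t_words (map (act point14 (coset_word i @ [\<xi>])) [1, 8])"
    by simp
  ultimately show ?thesis by (simp add: s_word_def)
qed

lemma t_word_partner: "i < 14 \<Longrightarrow> t_word i @ t_word ((i + 7) mod 14) \<approx> s_word (i mod 7)"
proof (cases "i < 7")
  case False
  moreover assume "i < 14"
  ultimately have "i mod 7 = i - 7" "i - 7 < 7" "i - 7 + 7 = i" "(i + 7) mod 14 = i - 7"
    by (auto simp: mod_if)
  then show ?thesis using t_word_commute[of "i - 7"] by simp
qed (simp add: s_word_def pe_refl)

lemma s_word_equivariant:
  assumes "nword w" "i < 7"
  shows "w @ s_word i \<approx> s_word (act point14 w i mod 7) @ w"
proof -
  have "w @ t_words [i, i + 7] \<approx> t_words (map (act point14 w) [i, i + 7]) @ w"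
    by (rule t_words_equivariant) (use assms in auto)
  also have "\<dots> \<approx> (t_word (act point14 w i) @ t_word ((act point14 w i + 7) mod 14)) @ w"
    using act_point14_partner[of i w] assms by (simp add: pe_refl)
  also have "\<dots> \<approx> s_word (act point14 w i mod 7) @ w"
    by (intro pres_eq_append_right t_word_partner act_point14_less) (use assms in auto)
  finally show ?thesis by (simp add: s_word_def)
qed

lemma s_word_conj_eq:
  assumes "s_word i @ s_word j \<approx> s_word k" "nword w" "i < 7" "j < 7" "k < 7"
  shows "s_word (act point14 w i mod 7) @ s_word (act point14 w j mod 7) \<approx> s_word (act point14 w k mod 7)"
proof (rule pres_eq_cancel_right)
  let ?f = "\<lambda>i. act point14 w i mod 7"
  have "(s_word (?f i) @ s_word (?f j)) @ w \<approx> s_word (?f i) @ w @ s_word j"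
    using pres_eq_append_left[OF pe_sym[OF s_word_equivariant[OF assms(2,4)]]] by simp
  also have "\<dots> \<approx> w @ s_word i @ s_word j"
    using pres_eq_append_right[OF pe_sym[OF s_word_equivariant[OF assms(2,3)]], of "s_word j"] by simp
  also have "\<dots> \<approx> w @ s_word k" by (rule pres_eq_append_left[OF assms(1)])
  also have "\<dots> \<approx> s_word (?f k) @ w" by (rule s_word_equivariant[OF assms(2,5)])
  finally show "(s_word (?f i) @ s_word (?f j)) @ w \<approx> s_word (?f k) @ w" .
qed

lemma s_word_square: "i < 7 \<Longrightarrow> s_word i @ s_word i \<approx> []"
proof -
  assume "i < 7"
  then have "s_word i @ s_word i \<approx> s_word i @ (t_word (i + 7) @ t_word i)"
    by (intro pres_eq_append_left pe_sym[OF t_word_commute])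
  also have "\<dots> \<approx> t_words ([i, i + 7] @ rev [i, i + 7])" by (simp add: s_word_def pe_refl)
  also have "\<dots> \<approx> []" by (rule t_words_rev)
  finally show ?thesis .
qed

lemma s_word_1_2: "s_word 1 @ s_word 2 \<approx> s_word 6"
proof -
  have "s_word 1 @ s_word 2 \<approx> s_word 1 @ s_word 2 @ s_word 6 @ s_word 6"
    using pres_eq_append_left[OF pe_sym[OF s_word_square[of 6]], of "s_word 1 @ s_word 2"] by simp
  also have "\<dots> \<approx> t_words [1, 8, 2, 9, 6, 13] @ s_word 6" by (simp add: s_word_def pe_refl)
  also have "\<dots> \<approx> [] @ s_word 6" by (rule pres_eq_append_right[OF t_words_line])
  finally show ?thesis by simp
qed

text \<open>Words for the stabiliser of block 1, of order 24: the \<open>v\<close> fix blocks 1 and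
  2 and take 3 to the four blocks off their line, and the \<open>u\<close> take 2 to each of the six
  blocks other than 1.\<close>

definition stab1_words :: "word list" where
  "stab1_words = [u @ v.
     u \<leftarrow> [[\<xi>, \<xi>, \<eta>, \<xi>'], [], [\<xi>, \<eta>, \<xi>', \<xi>'], [\<xi>, \<eta>, \<xi>, \<xi>, \<eta>], [\<xi>, \<xi>, \<xi>, \<eta>, \<xi>', \<xi>', \<xi>'], [\<xi>', \<eta>, \<xi>]],
     v \<leftarrow> [[\<xi>', \<xi>', \<eta>, \<xi>, \<xi>], [], [\<eta>, \<xi>, \<xi>, \<xi>, \<eta>, \<xi>, \<xi>, \<xi>], [\<eta>, \<xi>, \<xi>, \<eta>, \<xi>]]]"

lemma stab1_words_images:
  "map (\<lambda>w. map (\<lambda>i. act point14 w i mod 7) [1, 2, 3]) stab1_words =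
    [[1, 0, 3], [1, 0, 2], [1, 0, 6], [1, 0, 4], [1, 2, 0], [1, 2, 3], [1, 2, 4], [1, 2, 5],
     [1, 3, 2], [1, 3, 0], [1, 3, 5], [1, 3, 6], [1, 4, 0], [1, 4, 6], [1, 4, 2], [1, 4, 5],
     [1, 5, 6], [1, 5, 3], [1, 5, 4], [1, 5, 2], [1, 6, 0], [1, 6, 4], [1, 6, 3], [1, 6, 5]]"
  by code_simp

lemma stab1_words_nword: "w \<in> set stab1_words \<Longrightarrow> nword w"
  by (auto simp: stab1_words_def)

abbreviation bit_vec :: "bit \<Rightarrow> bit \<Rightarrow> bit \<Rightarrow> bit^3" where
  "bit_vec a b c \<equiv> (\<chi> i. if i = 1 then a else if i = 2 then b else c)"

text \<open>
  The labels are such that \<open>block_vec\<close> sums to 0 over each line \<open>{i, i + 1, i + 5}\<close> (modulo 7),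
  as \<open>s\<^sub>1 s\<^sub>2 s\<^sub>6 = 1\<close> requires.
\<close>

definition block_vec :: "nat \<Rightarrow> bit^3" where
  "block_vec i = [bit_vec 0 1 1, bit_vec 1 0 0, bit_vec 0 1 0, bit_vec 0 0 1,
            bit_vec 1 0 1, bit_vec 1 1 1, bit_vec 1 1 0] ! i"

lemma vec3_eq_iff: "v = w \<longleftrightarrow> v $ 1 = w $ 1 \<and> v $ 2 = w $ 2 \<and> v $ 3 = w $ 3" for v w :: "'a^3"
  by (simp add: vec_eq_iff forall_3)

lemma block_vec_simps:
  "block_vec 0 = bit_vec 0 1 1" "block_vec 1 = bit_vec 1 0 0" "block_vec (Suc 0) = bit_vec 1 0 0" "block_vec 2 = bit_vec 0 1 0" "block_vec 3 = bit_vec 0 0 1"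
  "block_vec 4 = bit_vec 1 0 1" "block_vec 5 = bit_vec 1 1 1" "block_vec 6 = bit_vec 1 1 0"
  by (simp_all add: block_vec_def)

lemma less_7_iff: "i < 7 \<longleftrightarrow> i \<in> {0, 1, 2, 3, 4, 5, 6 :: nat}"
  by auto

lemma block_vec_nonzero: "i < 7 \<Longrightarrow> block_vec i \<noteq> 0"
  by (auto simp: less_7_iff block_vec_simps vec3_eq_iff)

lemma block_vec_surj: "v \<noteq> 0 \<Longrightarrow> \<exists>i<7. block_vec i = v"
proof -
  assume "v \<noteq> 0"
  then have "\<exists>i\<in>{0, 1, 2, 3, 4, 5, 6}. block_vec i = v"
    by (cases "v $ 1"; cases "v $ 2"; cases "v $ 3") (auto simp: block_vec_simps vec3_eq_iff)
  then show ?thesis using less_7_iff by blast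
qed

lemma block_vec_inj: "i < 7 \<Longrightarrow> j < 7 \<Longrightarrow> block_vec i = block_vec j \<Longrightarrow> i = j"
  by (auto simp: less_7_iff block_vec_simps vec3_eq_iff)

lemma matrix_vector_3: "(A *v v) $ i = A $ i $ 1 * v $ 1 + A $ i $ 2 * v $ 2 + A $ i $ 3 * v $ 3"
  for A :: "bit^3^3"
  by (simp add: matrix_vector_mult_def sum_3)

definition columns :: "bit^3 \<Rightarrow> bit^3 \<Rightarrow> bit^3 \<Rightarrow> bit^3^3" where
  "columns u v w = (\<chi> i j. if j = 1 then u $ i else if j = 2 then v $ i else w $ i)"

text \<open>As \<open>block_vec\<close> labels 1, 2, 3 by the standard basis, the columns are the
  labels of the images of these blocks.\<close>

fun block_matrix :: "bool \<times> gen \<Rightarrow> bit^3^3" where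
  "block_matrix (False, GX) = columns (block_vec 0) (block_vec 1) (block_vec 2)"
| "block_matrix (True, GX) = columns (block_vec 2) (block_vec 3) (block_vec 4)"
| "block_matrix (_, GY) = columns (block_vec 5) (block_vec 3) (block_vec 2)"
| "block_matrix (_, GT) = mat 1"

lemma block_matrix_block_vec_check: "\<forall>c \<in> set letters. snd c \<noteq> GT \<longrightarrow> (\<forall>i\<in>{0, 1, 2, 3, 4, 5, 6}. block_matrix c *v block_vec i = block_vec (point14 c i mod 7))"
  unfolding letters_def
  by (simp add: block_vec_simps columns_def vec3_eq_iff matrix_vector_3)

lemma block_matrix_block_vec:
  assumes "snd c \<noteq> GT" "i < 14"
  shows "block_matrix c *v block_vec (i mod 7) = block_vec (point14 c i mod 7)"
proof -
  have "block_matrix c *v block_vec (i mod 7) = block_vec (point14 c (i mod 7) mod 7)"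
    using block_matrix_block_vec_check assms(1) less_7_iff[of "i mod 7"] in_letters[of c] by auto
  also have "point14 c (i mod 7) mod 7 = point14 c i mod 7"
    using act_point14_mod[OF assms(2), of "[c]"] by simp
  finally show ?thesis .
qed

lemma block_matrix_inverse: "block_matrix (b, g) ** block_matrix (\<not> b, g) = mat 1"
proof -
  have "\<forall>u. block_matrix (b, g) *v (block_matrix (\<not> b, g) *v u) = u"
    by (cases b; cases g) (auto simp: block_vec_simps columns_def vec3_eq_iff matrix_vector_3)
  then show ?thesis by (simp add: matrix_eq matrix_vector_mul_assoc[symmetric])
qed

lemma invertible_block_matrix: "invertible (block_matrix c)"
  using block_matrix_inverse[of "fst c" "snd c"] invertible_right_inverse by auto

section \<open>The action on 22 points\<close>

text \<open>
  Obtained by coset enumeration over a subgroup \<open>L\<^sub>3(4)\<close> of index 22. The orbit of \<open>M\<close> of length 8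
  is numbered from 0 to 7 such that \<open>s\<^sub>i\<close> adds \<open>block_vec i\<close>, read as a binary number, without carry.
\<close>

fun point22 :: "bool \<times> gen \<Rightarrow> nat \<Rightarrow> nat" where
  "point22 (False, GX) i = [0, 2, 4, 6, 3, 1, 7, 5, 14, 8, 9, 10, 11, 12, 13, 21, 15, 16, 17, 18, 19, 20] ! i"
| "point22 (True, GX) i = [0, 5, 1, 4, 2, 7, 3, 6, 9, 10, 11, 12, 13, 14, 8, 16, 17, 18, 19, 20, 21, 15] ! i"
| "point22 (_, GY) i = [5, 7, 4, 6, 2, 0, 3, 1, 11, 9, 10, 8, 12, 14, 13, 21, 19, 17, 18, 16, 20, 15] ! i"
| "point22 (_, GT) i = [8, 21, 13, 16, 14, 11, 19, 15, 0, 9, 10, 5, 12, 2, 4, 7, 3, 17, 18, 6, 20, 1] ! i"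

lemma point22_check:
  "list_all (\<lambda>c. list_all (\<lambda>i. point22 c i < 22 \<and> point22 c (point22 (\<not> fst c, snd c) i) = i) [0..<22]) letters"
  by code_simp

text \<open>A list form of the relators, for checking them by evaluation.\<close>

definition G_relator_list :: "word list" where
  "G_relator_list = [wpow wx 7, wpow wy 2, wpow (wx @ wy) 3, wpow (wcomm wx wy) 4, wpow wt 2,
     wcomm (wconj wt (wpow wx 2)) (wy @ winv wx), wcomm wt wy,
     wpow (wy @ wconj wt (wpow wx 2)) 5, wpow (wx @ wy @ wpow wx 2 @ wconj wt wx) 5,
     wpow (wx @ wt) 8]"

lemma set_G_relator_list: "set G_relator_list = G_relators"
  by (simp only: G_relators_def G_relator_list_def list.set)

lemma point22_relators:
  "list_all (\<lambda>r. list_all (\<lambda>i. act point22 r i = i) [0..<22]) G_relator_list"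
  by code_simp

lemma G_eq_act:
  assumes "u \<approx> v" "i < 22"
  shows "act point22 u i = act point22 v i"
proof (rule pres_eq_act[OF _ _ _ assms(1)])
  show "point22 c i \<in> {..<22}" if "i \<in> {..<22}" for c i
    using point22_check[unfolded list_all_iff, rule_format, of c i] that by auto
  show "point22 (b, g) (point22 (\<not> b, g) i) = i" if "i \<in> {..<22}" for b g i
    using point22_check[unfolded list_all_iff, rule_format, of "(b, g)" i] that by auto
  show "act point22 r i = i" if "r \<in> G_relators" "i \<in> {..<22}" for r i
    using that point22_relators[unfolded list_all_iff set_G_relator_list] by simp
qed (use assms in auto)

definition octad :: "bit^3 \<Rightarrow> nat" where
  "octad v = (if v $ 1 = 1 then 4 else 0) + (if v $ 2 = 1 then 2 else 0) + (if v $ 3 = 1 then 1 else 0)"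

lemma octad_less: "octad v < 22"
  by (simp add: octad_def)

lemma octad_inj: "octad u = octad v \<Longrightarrow> u = v"
  by (cases "u $ 1"; cases "u $ 2"; cases "u $ 3"; cases "v $ 1"; cases "v $ 2"; cases "v $ 3")
    (simp_all add: octad_def vec3_eq_iff)

definition affine_on :: "word \<Rightarrow> (bit^3) \<times> (bit^3^3) \<Rightarrow> bool" where
  "affine_on w p \<longleftrightarrow> (\<forall>u. act point22 w (octad u) = octad (fst p + snd p *v u))"

text \<open>The resulting pair is the product in \<open>AGL32\<close>; this becomes the homomorphism
  property.\<close>

lemma affine_on_append:
  "affine_on w (v, A) \<Longrightarrow> affine_on w' (v', A') \<Longrightarrow> affine_on (w @ w') (v + A *v v', A ** A')"
  by (simp add: affine_on_def matrix_vector_right_distrib matrix_vector_mul_assoc add.assoc)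

lemma affine_on_cong: "u \<approx> v \<Longrightarrow> affine_on u p \<longleftrightarrow> affine_on v p"
  using G_eq_act octad_less by (simp add: affine_on_def)

lemma affine_on_unique:
  assumes "affine_on w p" "affine_on w q" shows "p = q"
proof -
  have *: "fst p + snd p *v u = fst q + snd q *v u" for u
    using assms octad_inj by (metis affine_on_def)
  from *[of 0] have "fst p = fst q" by simp
  with * have "snd p = snd q" by (simp add: matrix_eq)
  then show ?thesis using \<open>fst p = fst q\<close> by (simp add: prod_eq_iff)
qed

text \<open>The translation part is the image of the point 0, which \<open>x\<close> fixes and
  \<open>y\<close> takes to 5, binary 101.\<close>

lemma affine_on_letter:
  assumes "snd c \<noteq> GT"
  shows "affine_on [c] (if snd c = GY then bit_vec 1 0 1 else 0, block_matrix c)"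
proof -
  have "affine_on [(b, g)] (if g = GY then bit_vec 1 0 1 else 0, block_matrix (b, g))" if "g \<noteq> GT" for b g
    unfolding affine_on_def
  proof
    fix u :: "bit^3"
    show "act point22 [(b, g)] (octad u) = octad (fst (if g = GY then bit_vec 1 0 1 else 0, block_matrix (b, g)) +
        snd (if g = GY then bit_vec 1 0 1 else 0, block_matrix (b, g)) *v u)"
      using that
      by (cases b; cases g; cases "u $ 1"; cases "u $ 2"; cases "u $ 3")
        (simp_all add: octad_def block_vec_simps columns_def matrix_vector_3)
  qed
  then show ?thesis using assms by (cases c) simp
qed

text \<open>Links the two actions of \<open>N\<close>: the linear part on the eight points is the
  permutation of the seven labels.\<close>

lemma nword_affine:
  "nword w \<Longrightarrow> \<exists>d A. affine_on w (d, A) \<and> invertible A \<and>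
    (\<forall>i<14. A *v block_vec (i mod 7) = block_vec (act point14 w i mod 7))"
proof (induction w)
  case Nil
  have "affine_on [] (0, mat 1)" by (simp add: affine_on_def)
  then show ?case
    by (intro exI[of _ 0] exI[of _ "mat 1"]) (auto simp: invertible_def intro!: exI[of _ "mat 1"])
next
  case (Cons c w)
  have c: "snd c \<noteq> GT" and "nword w" using Cons.prems by (cases c; simp)+
  then obtain d A where A: "affine_on w (d, A)" "invertible A"
    "\<And>i. i < 14 \<Longrightarrow> A *v block_vec (i mod 7) = block_vec (act point14 w i mod 7)"
    using Cons.IH by blast
  have "\<exists>d'. affine_on (c # w) (d', block_matrix c ** A)"
    using affine_on_append[OF affine_on_letter[OF c] A(1)] by auto
  moreover have "invertible (block_matrix c ** A)" by (rule invertible_mult[OF invertible_block_matrix A(2)])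
  moreover have "(block_matrix c ** A) *v block_vec (i mod 7) = block_vec (act point14 (c # w) i mod 7)" if "i < 14" for i
    using A(3)[OF that] block_matrix_block_vec[OF c act_point14_less[OF that, of w]]
    by (simp add: matrix_vector_mul_assoc[symmetric])
  ultimately show ?case by blast
qed

section \<open>Transitivity on triangles and products of the \<open>s_i\<close>\<close>

lemma matrix_vector_block_vec:
  fixes A :: "bit^3^3"
  shows "(A *v block_vec 1) $ i = A $ i $ 1" "(A *v block_vec 2) $ i = A $ i $ 2" "(A *v block_vec 3) $ i = A $ i $ 3"
  unfolding matrix_vector_3 block_vec_simps by simp_all

lemma matrix_eq_lamI:
  fixes A B :: "bit^3^3"
  assumes "A *v block_vec 1 = B *v block_vec 1" "A *v block_vec 2 = B *v block_vec 2" "A *v block_vec 3 = B *v block_vec 3"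
  shows "A = B"
  using assms unfolding vec_eq_iff matrix_vector_block_vec by (simp add: vec_eq_iff forall_3)

lemma stab1_images_complete:
  assumes "j < 7" "k < 7" "j \<noteq> 1" "k \<noteq> 1" "j \<noteq> k" "block_vec k \<noteq> block_vec 1 + block_vec j"
  shows "[1, j, k] \<in> set
    [[1, 0, 3], [1, 0, 2], [1, 0, 6], [1, 0, 4], [1, 2, 0], [1, 2, 3], [1, 2, 4], [1, 2, 5],
     [1, 3, 2], [1, 3, 0], [1, 3, 5], [1, 3, 6], [1, 4, 0], [1, 4, 6], [1, 4, 2], [1, 4, 5],
     [1, 5, 6], [1, 5, 3], [1, 5, 4], [1, 5, 2], [1, 6, 0], [1, 6, 4], [1, 6, 3], [1, 6, 5]]"
proof -
  have "j \<in> {0, 2, 3, 4, 5, 6}" "k \<in> {0, 2, 3, 4, 5, 6}" using assms by auto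
  then show ?thesis using assms(5,6)
    by (elim insertE emptyE; simp add: block_vec_simps vec3_eq_iff)
qed

text \<open>First \<open>a\<close> moves block 1 to \<open>i\<close>. Pulled back by
  \<open>a\<close>, the triple stays a triangle because \<open>a\<close> acts linearly on labels,
  and \<open>stab1_words\<close> reaches every triangle whose first block is 1.\<close>

lemma nword_transitive:
  assumes "i < 7" "j < 7" "k < 7" "i \<noteq> j" "k \<noteq> i" "k \<noteq> j" "block_vec k \<noteq> block_vec i + block_vec j"
  obtains w where "nword w" "act point14 w 1 mod 7 = i" "act point14 w 2 mod 7 = j" "act point14 w 3 mod 7 = k"
proof -
  define a where "a = coset_word i @ [\<xi>]"
  have a: "nword a" "act point14 a 1 = i" using assms by (simp_all add: a_def act_coset_word)
  have act_a: "act point14 a (act point14 (winv a) m mod 7) mod 7 = m" if "m < 7" for m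
  proof -
    have "act point14 a (act point14 (winv a) m mod 7) mod 7 = act point14 a (act point14 (winv a) m) mod 7"
      using that by (intro act_point14_mod act_point14_less) simp
    also have "act point14 a (act point14 (winv a) m) = m"
      using l32_act[OF pres_eq_winv_right[of _ a], of m] that by simp
    finally show ?thesis using that by simp
  qed
  define j' k' where "j' = act point14 (winv a) j mod 7" and "k' = act point14 (winv a) k mod 7"
  obtain d A where A: "\<And>m. m < 14 \<Longrightarrow> A *v block_vec (m mod 7) = block_vec (act point14 a m mod 7)"
    using nword_affine[OF a(1)] by blast
  have aj: "act point14 a j' mod 7 = j" "act point14 a k' mod 7 = k"
    using assms act_a by (auto simp: j'_def k'_def)
  have less: "j' < 7" "k' < 7" by (simp_all add: j'_def k'_def)
  have "block_vec k' \<noteq> block_vec 1 + block_vec j'"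
  proof
    assume "block_vec k' = block_vec 1 + block_vec j'"
    then have "A *v block_vec k' = A *v block_vec 1 + A *v block_vec j'" by (simp add: matrix_vector_right_distrib)
    then show False using A[of k'] A[of 1] A[of j'] less aj a assms by simp
  qed
  moreover have "j' \<noteq> 1" "k' \<noteq> 1" "j' \<noteq> k'" using aj a assms by auto
  ultimately have "[1, j', k'] \<in> set (map (\<lambda>w. map (\<lambda>i. act point14 w i mod 7) [1, 2, 3]) stab1_words)"
    unfolding stab1_words_images
    using stab1_images_complete less by blast
  then obtain b where b: "b \<in> set stab1_words" "act point14 b 1 mod 7 = 1" "act point14 b 2 mod 7 = j'" "act point14 b 3 mod 7 = k'"
    by auto
  have "act point14 (a @ b) m mod 7 = act point14 a (act point14 b m mod 7) mod 7" if "m < 14" for m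
    using act_point14_mod[OF act_point14_less[OF that, of b], of a] by simp
  note ab = this
  show thesis
  proof (rule that)
    show "nword (a @ b)" using a b stab1_words_nword by simp
    show "act point14 (a @ b) 1 mod 7 = i" using ab[of 1] a b assms by (simp del: act_simps)
    show "act point14 (a @ b) 2 mod 7 = j" using ab[of 2] b aj by (simp del: act_simps)
    show "act point14 (a @ b) 3 mod 7 = k" using ab[of 3] b aj by (simp del: act_simps)
  qed
qed

text \<open>A conjugate of \<open>s_1 s_2 = s_6\<close>: if \<open>w\<close> takes blocks 1, 2 to
  \<open>i\<close>, \<open>j\<close>, then by linearity it takes 6 to \<open>k\<close>.\<close>

lemma s_word_mult:
  assumes "i < 7" "j < 7" "k < 7" "block_vec k = block_vec i + block_vec j"
  shows "s_word i @ s_word j \<approx> s_word k"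
proof -
  have "i \<noteq> j" using block_vec_nonzero[OF assms(3)] assms(4) by (auto simp: vec3_eq_iff)
  \<comment> \<open>A third vertex is needed to apply \<open>nword_transitive\<close>; it exists
    since a line has three of the seven points.\<close>
  have "\<exists>m<7. m \<noteq> i \<and> m \<noteq> j \<and> block_vec m \<noteq> block_vec i + block_vec j"
  proof (rule ccontr)
    assume *: "\<not> ?thesis"
    have "m \<in> {i, j, k}" if "m < 7" for m using * that block_vec_inj assms by auto
    then have "{..<7} \<subseteq> {i, j, k}" by auto
    then have "card {..<7::nat} \<le> card {i, j, k}" by (intro card_mono) auto
    also have "\<dots> \<le> 3" by (simp add: card_insert_if)
    finally show False by simp
  qed
  then obtain m where m: "m < 7" "m \<noteq> i" "m \<noteq> j" "block_vec m \<noteq> block_vec i + block_vec j" by blast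
  obtain w where w: "nword w" "act point14 w 1 mod 7 = i" "act point14 w 2 mod 7 = j"
    using nword_transitive[OF assms(1,2) m(1) \<open>i \<noteq> j\<close> m(2-4)] .
  obtain d A where A: "\<And>m. m < 14 \<Longrightarrow> A *v block_vec (m mod 7) = block_vec (act point14 w m mod 7)"
    using nword_affine[OF w(1)] by blast
  have "block_vec 6 = block_vec 1 + block_vec 2" by (simp add: block_vec_simps vec3_eq_iff)
  then have "A *v block_vec 6 = A *v block_vec 1 + A *v block_vec 2" by (simp add: matrix_vector_right_distrib)
  then have "block_vec (act point14 w 6 mod 7) = block_vec k" using A[of 6] A[of 1] A[of 2] w assms by simp
  then have "act point14 w 6 mod 7 = k" using block_vec_inj assms by simp
  then show ?thesis using s_word_conj_eq[OF s_word_1_2 w(1)] w by simp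
qed

definition trans_word :: "bit^3 \<Rightarrow> word" where
  "trans_word v = (if v = 0 then [] else s_word (THE i. i < 7 \<and> block_vec i = v))"

lemma trans_word_0: "trans_word 0 = []" by (simp add: trans_word_def)

lemma trans_word_block_vec: "i < 7 \<Longrightarrow> trans_word (block_vec i) = s_word i"
proof -
  assume i: "i < 7"
  then have "(THE j. j < 7 \<and> block_vec j = block_vec i) = i" using block_vec_inj by (intro the_equality) auto
  then show ?thesis using block_vec_nonzero[OF i] by (simp add: trans_word_def)
qed

lemma trans_word_add: "trans_word u @ trans_word v \<approx> trans_word (u + v)"
proof (cases "u = 0 \<or> v = 0")
  case False
  then obtain i j where ij: "i < 7" "u = block_vec i" "j < 7" "v = block_vec j" using block_vec_surj by metis
  show ?thesis
  proof (cases "i = j")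
    case True
    have "block_vec j + block_vec j = 0" by (simp add: vec_eq_iff)
    then show ?thesis using True ij s_word_square by (simp add: trans_word_block_vec trans_word_0)
  next
    case False
    have "block_vec i + block_vec j \<noteq> 0"
    proof
      assume "block_vec i + block_vec j = 0"
      then have "block_vec i $ n + block_vec j $ n = 0" for n by (metis vector_add_component zero_index)
      then have "block_vec i $ n = block_vec j $ n" for n
        by (cases "block_vec i $ n"; cases "block_vec j $ n") (metis add_0_left add_0_right)+
      then have "block_vec i = block_vec j" by (simp add: vec_eq_iff)
      then show False using block_vec_inj ij False by simp
    qed
    then obtain k where "k < 7" "block_vec k = block_vec i + block_vec j" using block_vec_surj by metis
    then show ?thesis using s_word_mult[OF ij(1,3)] ij trans_word_block_vec by metis
  qed
qed (auto simp: trans_word_0 pe_refl)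

lemma trans_word_conj: "nword w \<Longrightarrow> \<exists>v'. w @ trans_word v \<approx> trans_word v' @ w"
proof (cases "v = 0")
  case False
  assume w: "nword w"
  obtain i where i: "i < 7" "v = block_vec i" using False block_vec_surj by metis
  then show ?thesis
    using s_word_equivariant[OF w i(1)] trans_word_block_vec[of "act point14 w i mod 7"] by (metis mod_less_divisor trans_word_block_vec zero_less_numeral)
qed (auto simp: trans_word_0 pe_refl intro: exI[of _ 0])

text \<open>Row \<open>i\<close> is addition without carry of the binary number
  \<open>block_vec i\<close>.\<close>

lemma s_word_octad:
  "map (\<lambda>i. map (act point22 (s_word i)) [0..<8]) [0..<7] =
    [[3, 2, 1, 0, 7, 6, 5, 4], [4, 5, 6, 7, 0, 1, 2, 3], [2, 3, 0, 1, 6, 7, 4, 5], [1, 0, 3, 2, 5, 4, 7, 6],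
     [5, 4, 7, 6, 1, 0, 3, 2], [7, 6, 5, 4, 3, 2, 1, 0], [6, 7, 4, 5, 2, 3, 0, 1]]"
  by code_simp

lemma s_word_affine:
  assumes "i < 7" shows "affine_on (s_word i) (block_vec i, mat 1)"
proof -
  have *: "act point22 (s_word i) n = map (\<lambda>i. map (act point22 (s_word i)) [0..<8]) [0..<7] ! i ! n" if "n < 8" for n
    using assms that by simp
  show ?thesis
    unfolding affine_on_def
  proof
    fix u
    have "octad u < 8" by (simp add: octad_def)
    then have "act point22 (s_word i) (octad u) = octad (block_vec i + u)"
      unfolding *[OF \<open>octad u < 8\<close>] s_word_octad using assms unfolding less_7_iff
      by (elim insertE emptyE; cases "u $ 1"; cases "u $ 2"; cases "u $ 3"; simp add: octad_def block_vec_simps)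
    then show "act point22 (s_word i) (octad u) = octad (fst (block_vec i, mat 1) + snd (block_vec i, mat 1) *v u)" by simp
  qed
qed

lemma trans_word_affine: "affine_on (trans_word v) (v, mat 1)"
proof (cases "v = 0")
  case False
  then obtain i where "i < 7" "block_vec i = v" using block_vec_surj by metis
  then show ?thesis using s_word_affine trans_word_block_vec by metis
qed (simp add: trans_word_0 affine_on_def)

section \<open>The isomorphism\<close>

abbreviation cl :: "word \<Rightarrow> word set" where "cl \<equiv> pcls G_relators"

lemma cl_eq_iff: "cl u = cl v \<longleftrightarrow> u \<approx> v"
  unfolding pcls_def by (auto intro: pres_eq.intros)

lemma mem_cl: "w \<in> cl w"
  by (simp add: pcls_def pe_refl)

lemma cl_mult [simp]: "cl u \<otimes>\<^bsub>GG\<^esub> cl v = cl (u @ v)"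
  unfolding GG_def pres_group_def pcls_def
  by (auto intro: pe_refl pe_trans pres_eq_append)

lemma GG_one: "\<one>\<^bsub>GG\<^esub> = cl []" and GG_carrier: "carrier GG = range cl"
  by (auto simp: GG_def pres_group_def)

lemma cl_carrier [simp]: "cl w \<in> carrier GG"
  by (simp add: GG_carrier)

lemma group_GG: "group GG"
proof (rule groupI)
  show "\<exists>y\<in>carrier GG. y \<otimes>\<^bsub>GG\<^esub> x = \<one>\<^bsub>GG\<^esub>" if "x \<in> carrier GG" for x
  proof -
    from that obtain w where "x = cl w" by (auto simp: GG_carrier)
    then show ?thesis
      by (intro bexI[of _ "cl (winv w)"]) (simp_all add: GG_one cl_eq_iff pres_eq_winv_left)
  qed
qed (auto simp: GG_one GG_carrier)

lemma inv_cl: "inv\<^bsub>GG\<^esub> (cl w) = cl (winv w)"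
  by (rule group.inv_equality[OF group_GG])
    (simp_all add: GG_one cl_eq_iff pres_eq_winv_left)

text \<open>\<open>t8_word\<close> conjugates by \<open>x^5 y\<close>, \<open>t_word 8\<close> by
  \<open>coset_word 8\<close>; both conjugations lead from 0 to 8, so equivariance identifies the
  results.\<close>

lemma gs1_eq: "gs1 = cl (s_word 1)"
proof -
  let ?w = "winv (wpow wx 5 @ wy)"
  have w: "?w = [(True, GY), \<xi>', \<xi>', \<xi>', \<xi>', \<xi>']" by (simp add: wpow_5)
  have "?w @ t_word 0 \<approx> t_word (act point14 ?w 0) @ ?w" by (rule t_word_equivariant) (simp_all add: wpow_5)
  also have "act point14 ?w 0 = 8" unfolding w by simp
  finally have "(?w @ t_word 0) @ winv ?w \<approx> (t_word 8 @ ?w) @ winv ?w" by (rule pres_eq_append_right)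
  also have "\<dots> \<approx> t_word 8" using pres_eq_append_left[OF pres_eq_winv_right[of _ ?w], of G_relators "t_word 8"] by simp
  finally have "t8_word \<approx> t_word 8" by (simp add: t8_word_def wconj_def t_word_def coset_word_def)
  moreover have "t1_word = t_word 1" by (simp only: t1_word_def t_word_1)
  ultimately show ?thesis unfolding gs1_def cl_eq_iff s_word_def by (simp add: pres_eq_append_left)
qed

section \<open>Elements of \<open>M\<close> as translations times elements of
  \<open>N\<close>\<close>

definition M :: "word set set" where "M = generate GG {gx, gy, gs1}"

definition M_element :: "bit^3 \<Rightarrow> word \<Rightarrow> word set" where "M_element v w = cl (trans_word v @ w)"

lemma M_element_mult:
  assumes "nword w" "nword w'" shows "\<exists>u. M_element v w \<otimes>\<^bsub>GG\<^esub> M_element v' w' = M_element u (w @ w')"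
proof -
  obtain u where u: "w @ trans_word v' \<approx> trans_word u @ w" using trans_word_conj[OF assms(1)] by blast
  have "trans_word v @ (w @ trans_word v') @ w' \<approx> trans_word v @ (trans_word u @ w) @ w'"
    by (intro pres_eq_append_left pres_eq_append_right u)
  also have "\<dots> \<approx> (trans_word v @ trans_word u) @ w @ w'" by (simp add: pe_refl)
  also have "\<dots> \<approx> trans_word (v + u) @ w @ w'" by (intro pres_eq_append_right trans_word_add)
  finally show ?thesis unfolding M_element_def by (auto simp: cl_eq_iff)
qed

lemma trans_word_block_vec_1: "trans_word (block_vec 1) = s_word 1"
  by (simp add: trans_word_block_vec)

lemma s_word_1_self_inverse: "winv (s_word 1) \<approx> s_word 1"
proof -
  have "winv (s_word 1) \<approx> winv (s_word 1) @ s_word 1 @ s_word 1"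
    using pres_eq_append_left[OF pe_sym[OF s_word_square[of 1]], of "winv (s_word 1)"] by simp
  also have "\<dots> \<approx> s_word 1" by (rule pres_eq_cancel)
  finally show ?thesis .
qed

lemma gens_M_element: "gx = M_element 0 [\<xi>]" "gy = M_element 0 [\<eta>]" "gs1 = M_element (block_vec 1) []"
  by (simp_all only: gx_def gy_def gs1_eq M_element_def trans_word_0 trans_word_block_vec_1 append_Nil append_Nil2)

lemma inv_gens_M_element: "inv\<^bsub>GG\<^esub> gx = M_element 0 [\<xi>']" "inv\<^bsub>GG\<^esub> gy = M_element 0 [(True, GY)]" "inv\<^bsub>GG\<^esub> gs1 = M_element (block_vec 1) []"
proof -
  show "inv\<^bsub>GG\<^esub> gx = M_element 0 [\<xi>']" "inv\<^bsub>GG\<^esub> gy = M_element 0 [(True, GY)]"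
    by (simp_all add: gx_def gy_def inv_cl M_element_def trans_word_0)
  show "inv\<^bsub>GG\<^esub> gs1 = M_element (block_vec 1) []"
    using s_word_1_self_inverse
    by (simp only: gs1_eq inv_cl M_element_def trans_word_block_vec_1 append_Nil2 cl_eq_iff)
qed

lemma M_decompose: "C \<in> M \<Longrightarrow> \<exists>v w. nword w \<and> C = M_element v w"
  unfolding M_def
proof (induction rule: generate.induct)
  case one
  then show ?case by (intro exI[of _ 0] exI[of _ "[]"]) (simp add: GG_one M_element_def trans_word_0)
next
  case (incl C)
  moreover have "nword [\<xi>]" "nword [\<eta>]" "nword []" by simp_all
  ultimately show ?case using gens_M_element by blast
next
  case (inv C)
  moreover have "nword [\<xi>']" "nword [(True, GY)]" "nword []" by simp_all
  ultimately show ?case using inv_gens_M_element by blast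
next
  case (eng C D)
  then obtain v w v' w' where "nword w" "C = M_element v w" "nword w'" "D = M_element v' w'" by blast
  moreover from this obtain u where "M_element v w \<otimes>\<^bsub>GG\<^esub> M_element v' w' = M_element u (w @ w')"
    using M_element_mult by blast
  ultimately show ?case by (intro exI[of _ u] exI[of _ "w @ w'"]) simp
qed

lemma nword_M: "nword w \<Longrightarrow> cl w \<in> M"
proof (induction w)
  case Nil
  then show ?case using generate.one[of GG] by (simp add: M_def GG_one)
next
  case (Cons c w)
  have "cl [\<xi>] \<in> M" "cl [\<eta>] \<in> M" unfolding M_def gx_def[symmetric] gy_def[symmetric]
    by (auto intro: generate.incl)
  moreover have "cl [\<xi>'] \<in> M" "cl [(True, GY)] \<in> M"
    using generate.inv[of gx "{gx, gy, gs1}" GG] generate.inv[of gy "{gx, gy, gs1}" GG]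
    by (simp_all add: M_def gx_def gy_def inv_cl)
  ultimately have "cl [c] \<in> M" using Cons.prems by (cases c; cases "fst c"; cases "snd c") auto
  moreover have "cl w \<in> M" using Cons by (cases c) simp
  ultimately have "cl [c] \<otimes>\<^bsub>GG\<^esub> cl w \<in> M" unfolding M_def by (rule generate.eng)
  then show ?case by simp
qed

lemma M_element_in_M:
  assumes "nword w" shows "M_element v w \<in> M"
proof -
  have "cl (trans_word v) \<in> M"
  proof (cases "v = 0")
    case True
    then show ?thesis using nword_M[of "[]"] by (simp add: trans_word_0)
  next
    case False
    then obtain i where i: "i < 7" "block_vec i = v" using block_vec_surj by metis
    \<comment> \<open>This word takes block 1 to \<open>i\<close>, so it conjugates the generator
      \<open>s_1\<close> to \<open>s_i\<close>.\<close>
    let ?w = "coset_word i @ [\<xi>]"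
    have "?w @ s_word 1 \<approx> s_word i @ ?w" using s_word_equivariant[of ?w 1] i by (simp add: act_coset_word)
    then have "(?w @ s_word 1) @ winv ?w \<approx> (s_word i @ ?w) @ winv ?w" by (rule pres_eq_append_right)
    also have "\<dots> \<approx> s_word i"
      using pres_eq_append_left[OF pres_eq_winv_right[of _ ?w], of G_relators "s_word i"] by simp
    finally have "cl (trans_word v) = cl ?w \<otimes>\<^bsub>GG\<^esub> cl (s_word 1) \<otimes>\<^bsub>GG\<^esub> cl (winv ?w)"
      using trans_word_block_vec[OF i(1)] i(2) unfolding cl_mult cl_eq_iff by (auto intro: pe_sym)
    moreover have "cl (s_word 1) \<in> M" unfolding M_def gs1_eq[symmetric] by (auto intro: generate.incl)
    moreover have "cl ?w \<in> M" "cl (winv ?w) \<in> M" by (rule nword_M; simp)+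
    ultimately show ?thesis unfolding M_def by (metis generate.eng)
  qed
  then have "cl (trans_word v) \<otimes>\<^bsub>GG\<^esub> cl w \<in> M" using nword_M[OF assms] unfolding M_def by (rule generate.eng)
  then show ?thesis by (simp add: M_element_def)
qed

text \<open>All representatives of a class act alike on the eight points, so the description is
  unique whenever one of them acts affinely, as for every class in \<open>M\<close>.\<close>

definition affine_map :: "word set \<Rightarrow> (bit^3) \<times> (bit^3^3)" where
  "affine_map C = (THE p. \<exists>w\<in>C. affine_on w p)"

lemma affine_map_eq:
  assumes "affine_on w p" shows "affine_map (cl w) = p"
  unfolding affine_map_def
proof (rule the_equality)
  show "\<exists>w\<in>cl w. affine_on w p" using assms mem_cl by blast
  show "q = p" if "\<exists>w\<in>cl w. affine_on w q" for q
    using that assms affine_on_cong affine_on_unique unfolding pcls_def by blast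
qed

lemma M_element_affine:
  assumes "affine_on w (d, A)" shows "affine_on (trans_word v @ w) (v + d, A)"
  using affine_on_append[OF trans_word_affine assms] by simp

theorem theorem3p6:
  shows "GG\<lparr>carrier := generate GG {gx, gy, gs1}\<rparr> \<cong> AGL32"
proof (rule is_isoI, unfold iso_def, intro CollectI conjI)
  let ?G = "GG\<lparr>carrier := generate GG {gx, gy, gs1}\<rparr>"
  have carrier: "carrier ?G = M" by (simp add: M_def)
  have affine_map_M: "\<exists>w d A. C = cl w \<and> affine_on w (d, A) \<and> invertible A" if C: "C \<in> M" for C
  proof -
    obtain v w where w: "nword w" "C = cl (trans_word v @ w)" using M_decompose[OF C] unfolding M_element_def by blast
    then show ?thesis using nword_affine[OF w(1)] M_element_affine by blast
  qed
  show "affine_map \<in> hom ?G AGL32"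
  proof (rule homI)
    show "affine_map C \<in> carrier AGL32" if "C \<in> carrier ?G" for C
      using affine_map_M[OF that[unfolded carrier]] affine_map_eq by (auto simp: AGL32_def)
    show "affine_map (C \<otimes>\<^bsub>?G\<^esub> D) = affine_map C \<otimes>\<^bsub>AGL32\<^esub> affine_map D" if C: "C \<in> carrier ?G" and D: "D \<in> carrier ?G" for C D
    proof -
      obtain w d A where w: "C = cl w" "affine_on w (d, A)"
        using affine_map_M[OF C[unfolded carrier]] by blast
      obtain w' d' A' where w': "D = cl w'" "affine_on w' (d', A')"
        using affine_map_M[OF D[unfolded carrier]] by blast
      show ?thesis
        using affine_map_eq[OF affine_on_append[OF w(2) w'(2)]] affine_map_eq[OF w(2)] affine_map_eq[OF w'(2)]
        by (simp add: w(1) w'(1) AGL32_def)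
    qed
  qed
  have "inj_on affine_map M"
  proof (rule inj_onI)
    fix C D assume "C \<in> M" "D \<in> M" and eq: "affine_map C = affine_map D"
    then obtain v w v' w' where w: "nword w" "C = M_element v w" and w': "nword w'" "D = M_element v' w'"
      using M_decompose by blast
    obtain d A where A: "affine_on w (d, A)" "\<And>i. i < 14 \<Longrightarrow> A *v block_vec (i mod 7) = block_vec (act point14 w i mod 7)"
      using nword_affine[OF w(1)] by blast
    obtain d' A' where A': "affine_on w' (d', A')" "\<And>i. i < 14 \<Longrightarrow> A' *v block_vec (i mod 7) = block_vec (act point14 w' i mod 7)"
      using nword_affine[OF w'(1)] by blast
    have "(v + d, A) = (v' + d', A')"
      using eq affine_map_eq[OF M_element_affine[OF A(1), of v]] affine_map_eq[OF M_element_affine[OF A'(1), of v']] w w'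
      by (simp add: M_element_def)
    then have AA: "v + d = v' + d'" "A = A'" by auto
    \<comment> \<open>Equal linear parts mean that \<open>w\<close> and \<open>w'\<close> move the
      blocks alike, so they agree in \<open>N\<close> by faithfulness; the translations
      \<open>v\<close> and \<open>v'\<close> then agree too.\<close>
    have fix_block: "act point14 (winv w' @ w) i mod 7 = i" if "i < 7" for i
    proof -
      have same: "act point14 w i mod 7 = act point14 w' i mod 7"
        using A(2)[of i] A'(2)[of i] AA that by (intro block_vec_inj) auto
      have "act point14 (winv w') (act point14 w i) mod 7 = act point14 (winv w') (act point14 w i mod 7) mod 7"
        using that by (intro act_point14_mod[symmetric] act_point14_less) simp
      also have "\<dots> = act point14 (winv w') (act point14 w' i) mod 7"
        unfolding same using that by (intro act_point14_mod act_point14_less) simp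
      also have "act point14 (winv w') (act point14 w' i) = i"
        using l32_act[OF pres_eq_winv_left[of _ w'], of i] that by simp
      finally show ?thesis using that by simp
    qed
    have "winv w' @ w \<sim> []"
      by (rule nword_fixing_blocks) (use w w' fix_block[of 1] fix_block[of 2] fix_block[of 3] in simp_all)
    then have "w' @ winv w' @ w \<approx> w' @ []" by (intro pres_eq_append_left l32_eq_G_eq)
    then have "w \<approx> w'" unfolding append_Nil2 by (rule pe_trans[OF pe_sym[OF pres_eq_cancel(1)]])
    moreover from this have "d = d'"
      using A(1) A'(1) affine_on_cong affine_on_unique by blast
    then have "v = v'" using AA by simp
    ultimately show "C = D" by (simp add: w w' M_element_def cl_eq_iff pres_eq_append_left)
  qed
  moreover have "affine_map ` M = carrier AGL32"
  proof (intro equalityI subsetI)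
    fix p assume "p \<in> affine_map ` M"
    then obtain C where "C \<in> M" "p = affine_map C" by blast
    then show "p \<in> carrier AGL32" using affine_map_M[of C] affine_map_eq by (auto simp: AGL32_def)
  next
    fix p assume p: "p \<in> carrier AGL32"
    obtain v A where vA: "p = (v, A)" "invertible A" using p by (auto simp: AGL32_def)
    have inj: "x = y" if "A *v x = A *v y" for x y
      using that vA(2) by (metis invertible_def matrix_vector_mul_assoc matrix_vector_mul_lid)
    have nz: "A *v block_vec n \<noteq> 0" if "n < 7" for n
      using inj[of "block_vec n" 0] block_vec_nonzero[OF that] by auto
    \<comment> \<open>The images of the basis vectors under \<open>A\<close> label a triangle of
      blocks, which \<open>nword_transitive\<close> reaches from 1, 2, 3.\<close>
    obtain i where i: "i < 7" "block_vec i = A *v block_vec 1" using block_vec_surj[OF nz[of 1]] by auto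
    obtain j where j: "j < 7" "block_vec j = A *v block_vec 2" using block_vec_surj[OF nz[of 2]] by auto
    obtain k where k: "k < 7" "block_vec k = A *v block_vec 3" using block_vec_surj[OF nz[of 3]] by auto
    have "block_vec 1 \<noteq> block_vec 2" "block_vec 3 \<noteq> block_vec 1" "block_vec 3 \<noteq> block_vec 2" "block_vec 3 \<noteq> block_vec 1 + block_vec 2"
      by (simp_all add: block_vec_simps vec3_eq_iff)
    then have "block_vec i \<noteq> block_vec j" "block_vec k \<noteq> block_vec i" "block_vec k \<noteq> block_vec j" "block_vec k \<noteq> block_vec i + block_vec j"
      unfolding i j k matrix_vector_right_distrib[symmetric] using inj by blast+
    then have "i \<noteq> j" "k \<noteq> i" "k \<noteq> j" "block_vec k \<noteq> block_vec i + block_vec j" by auto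
    then obtain w where w: "nword w" "act point14 w 1 mod 7 = i" "act point14 w 2 mod 7 = j" "act point14 w 3 mod 7 = k"
      by (rule nword_transitive[OF i(1) j(1) k(1)])
    obtain d B where B: "affine_on w (d, B)" "\<And>i. i < 14 \<Longrightarrow> B *v block_vec (i mod 7) = block_vec (act point14 w i mod 7)"
      using nword_affine[OF w(1)] by blast
    have "B = A"
      using B(2)[of 1] B(2)[of 2] B(2)[of 3] w i(2) j(2) k(2) by (intro matrix_eq_lamI) simp_all
    \<comment> \<open>The element of \<open>N\<close> with linear part \<open>A\<close> brings its
      own translation \<open>d\<close>, which \<open>v - d\<close> corrects.\<close>
    then have "affine_on (trans_word (v - d) @ w) (v, A)" using M_element_affine[OF B(1), of "v - d"] by simp
    then have "affine_map (M_element (v - d) w) = p" unfolding M_element_def vA by (rule affine_map_eq)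
    then show "p \<in> affine_map ` M" using M_element_in_M[OF w(1)] by blast
  qed
  ultimately show "bij_betw affine_map (carrier ?G) (carrier AGL32)"
    by (simp add: bij_betw_def M_def)
qed

end
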